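(* Let $G$ be a profinite-$C$ group. Then the following are equivalent: (i) $G$ is a $C$-group; (ii) $G$ is a torsion group and $|G:Z(G)\overline{G'}|<\infty$, where $\overline{G'}$ is the topological closure of the derived subgroup of $G$. In particular, an abelian profinite-$C$ group is a $C$-group if and only if it is torsion.
   Context: A permutable complement of a subgroup $H$ of a group $G$ is a subgroup $K$ with $G=HK$ and $H\cap K=1$. A group is a $C$-group if every subgroup has a permutable complement. A profinite group $G$ is a profinite-$C$ group if every closed subgroup of $G$ has a closed permutable complement in $G$. $Z(G)$ denotes the center of $G$. *)

theory Defs
  imports "HOL-Analysis.Analysis" "HOL-Algebra.Algebra"
begin

definition topological_group :: "('a, 'b) monoid_scheme \<Rightarrow> 'a topology \<Rightarrow> bool" where
  "topological_group G T \<longleftrightarrow> group G \<and> topspace T = carrier G \<and>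
     continuous_map (prod_topology T T) T (\<lambda>(x, y). x \<otimes>\<^bsub>G\<^esub> y) \<and>
     continuous_map T T (\<lambda>x. inv\<^bsub>G\<^esub> x)"

definition totally_disconnected_space :: "'a topology \<Rightarrow> bool" where
  "totally_disconnected_space T \<longleftrightarrow>
     (\<forall>x \<in> topspace T. connected_component_of_set T x = {x})"

definition profinite_group :: "('a, 'b) monoid_scheme \<Rightarrow> 'a topology \<Rightarrow> bool" where
  "profinite_group G T \<longleftrightarrow> topological_group G T \<and> compact_space T \<and>
     Hausdorff_space T \<and> totally_disconnected_space T"

definition perm_complement :: "('a, 'b) monoid_scheme \<Rightarrow> 'a set \<Rightarrow> 'a set \<Rightarrow> bool" where
  "perm_complement G H K \<longleftrightarrow> subgroup K G \<and> H <#>\<^bsub>G\<^esub> K = carrier G \<and> H \<inter> K = {\<one>\<^bsub>G\<^esub>}"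

definition C_group :: "('a, 'b) monoid_scheme \<Rightarrow> bool" where
  "C_group G \<longleftrightarrow> (\<forall>H. subgroup H G \<longrightarrow> (\<exists>K. perm_complement G H K))"

definition profinite_C_group :: "('a, 'b) monoid_scheme \<Rightarrow> 'a topology \<Rightarrow> bool" where
  "profinite_C_group G T \<longleftrightarrow> profinite_group G T \<and>
     (\<forall>H. subgroup H G \<and> closedin T H \<longrightarrow> (\<exists>K. closedin T K \<and> perm_complement G H K))"

definition group_center :: "('a, 'b) monoid_scheme \<Rightarrow> 'a set" where
  "group_center G = {z \<in> carrier G. \<forall>x \<in> carrier G. z \<otimes>\<^bsub>G\<^esub> x = x \<otimes>\<^bsub>G\<^esub> z}"

definition torsion_group :: "('a, 'b) monoid_scheme \<Rightarrow> bool" where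
  "torsion_group G \<longleftrightarrow> (\<forall>x \<in> carrier G. \<exists>n::nat. n > 0 \<and> x [^]\<^bsub>G\<^esub> n = \<one>\<^bsub>G\<^esub>)"

end

theory Submission
  imports Defs
begin

text \<open>
  Call an element of prime order an \<^emph>\<open>eigenelement\<close> if the subgroup it generates is normal. If \<open>A\<close> is
  an abelian normal torsion subgroup all of whose subgroups have permutable complements in \<open>G\<close>, then
  \<open>A\<close> is generated by eigenelements: \<open>K \<inter> A\<close> is normal for every complement \<open>K\<close> of a subgroup of \<open>A\<close>,
  so \<open>A\<close> is semisimple as a \<open>G\<close>-module, with simple summands of prime order. Hence \<open>G'\<close> centralizes \<open>A\<close>.

  A finite C-group is metabelian: a complement of a cyclic subgroup of least possible order is normal,
  so \<open>G''\<close> is abelian by induction; then \<open>G'\<close> centralizes \<open>G''\<close>, which forces \<open>G''\<close> into its own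
  complement. In a profinite C-group the complements of open normal subgroups are finite
  C-groups, so the closure \<open>A\<close> of \<open>G'\<close> is abelian and has an abelian complement \<open>B\<close>.

  If \<open>G\<close> is torsion and \<open>Z(G)A\<close> has finite index, then each element of \<open>A\<close> lies in a finite normal
  subgroup, so \<open>A\<close> is generated by eigenelements. Given a subgroup \<open>H\<close>, Zorn's lemma yields a normal
  complement \<open>W\<close> of \<open>H \<inter> A\<close> in \<open>A\<close>, and \<open>W F\<close> is a complement of \<open>H\<close> for a complement \<open>F\<close> of
  \<open>HA \<inter> B\<close> in \<open>B\<close>.

  If \<open>G\<close> is a C-group, every element of \<open>A\<close> is a product of eigenelements and so has finitely many
  conjugates; by Baire the class sizes on \<open>A\<close> are bounded. Multiplying an element by an eigenelement
  not centralized by its centralizer enlarges its class, so an element of \<open>A\<close> with a class of maximal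
  size has centralizer \<open>C(A)\<close>, which is contained in \<open>Z(G)A\<close>.
\<close>

context group
begin

subsection \<open>Conjugation and centralizers\<close>

lemma l_inv_cancel: "\<lbrakk>x \<in> carrier G; y \<in> carrier G\<rbrakk> \<Longrightarrow> inv x \<otimes> (x \<otimes> y) = y"
  by (simp add: m_assoc[symmetric])

lemma r_inv_cancel: "\<lbrakk>x \<in> carrier G; y \<in> carrier G\<rbrakk> \<Longrightarrow> x \<otimes> (inv x \<otimes> y) = y"
  by (simp add: m_assoc[symmetric])

text \<open>As rewrite rules these bring a word to right-associated form, push inverses down to
  single letters and cancel neighbouring inverse letters, so that \<open>simp\<close> proves word
  identities valid in every group.\<close>

lemmas group_normalize = m_assoc inv_mult_group l_inv_cancel r_inv_cancel

lemma conj_mult: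
  assumes "g \<in> carrier G" "x \<in> carrier G" "y \<in> carrier G"
  shows "g \<otimes> (x \<otimes> y) \<otimes> inv g = (g \<otimes> x \<otimes> inv g) \<otimes> (g \<otimes> y \<otimes> inv g)"
  using assms by (simp add: group_normalize)

lemma conj_inv:
  assumes "g \<in> carrier G" "x \<in> carrier G"
  shows "g \<otimes> inv x \<otimes> inv g = inv (g \<otimes> x \<otimes> inv g)"
  using assms by (simp add: group_normalize)

lemma conj_int_pow:
  assumes "g \<in> carrier G" "x \<in> carrier G"
  shows "g \<otimes> (x [^] (i::int)) \<otimes> inv g = (g \<otimes> x \<otimes> inv g) [^] i"
proof -
  have "(\<lambda>x. g \<otimes> x \<otimes> inv g) \<in> hom G G"
    using assms by (auto intro!: homI simp: conj_mult)
  from hom_int_pow[OF this assms(2)] show ?thesis by simp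
qed

lemma conj_fixed_iff_commute:
  assumes "g \<in> carrier G" "x \<in> carrier G"
  shows "g \<otimes> x \<otimes> inv g = x \<longleftrightarrow> g \<otimes> x = x \<otimes> g"
  using assms by (metis inv_solve_right' m_closed)

lemma commute_inv_right:
  assumes "x \<in> carrier G" "y \<in> carrier G" "x \<otimes> y = y \<otimes> x"
  shows "x \<otimes> inv y = inv y \<otimes> x"
  using assms by (metis inv_closed inv_solve_left inv_solve_right m_assoc m_closed)

lemma subgroup_centralizer:
  assumes S: "S \<subseteq> carrier G"
  shows "subgroup {g \<in> carrier G. \<forall>s\<in>S. g \<otimes> s = s \<otimes> g} G" (is "subgroup ?C G")
proof (rule subgroupI)
  have "\<one> \<in> ?C" using S by auto
  then show "?C \<noteq> {}" by blast
next
  fix g assume g: "g \<in> ?C"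
  have "inv g \<otimes> s = s \<otimes> inv g" if "s \<in> S" for s
    using commute_inv_right[of s g] g S that by auto
  then show "inv g \<in> ?C" using g by simp
next
  fix g h assume g: "g \<in> ?C" and h: "h \<in> ?C"
  have "g \<otimes> h \<otimes> s = s \<otimes> (g \<otimes> h)" if s: "s \<in> S" for s
  proof -
    have c: "g \<in> carrier G" "h \<in> carrier G" "s \<in> carrier G" using g h s S by auto
    have "g \<otimes> h \<otimes> s = g \<otimes> (s \<otimes> h)" using c h s by (simp add: m_assoc)
    also have "\<dots> = g \<otimes> s \<otimes> h" using c by (simp add: m_assoc)
    also have "\<dots> = s \<otimes> (g \<otimes> h)" using c g s by (simp add: m_assoc)
    finally show ?thesis .
  qed
  then show "g \<otimes> h \<in> ?C" using g h by simp
qed auto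

text \<open>The centralizer of \<open>S\<close> is a subgroup, so it contains
  \<open>generate G R\<close> once it contains \<open>R\<close>; the same argument with the
  centralizer of \<open>generate G R\<close> then absorbs \<open>generate G S\<close>.\<close>

lemma generate_centralizes:
  assumes "S \<subseteq> carrier G" "R \<subseteq> carrier G"
    and comm: "\<And>r s. \<lbrakk>r \<in> R; s \<in> S\<rbrakk> \<Longrightarrow> r \<otimes> s = s \<otimes> r"
    and "r \<in> generate G R" "s \<in> generate G S"
  shows "r \<otimes> s = s \<otimes> r"
proof -
  let ?C = "\<lambda>S. {g \<in> carrier G. \<forall>s\<in>S. g \<otimes> s = s \<otimes> g}"
  have gR: "generate G R \<subseteq> carrier G"
    using generate_incl[OF assms(2)] .
  have "generate G R \<subseteq> ?C S"
    using assms(2) comm by (intro generate_subgroup_incl subgroup_centralizer[OF assms(1)]) auto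
  then have "generate G S \<subseteq> ?C (generate G R)"
  proof (intro generate_subgroup_incl[OF _ subgroup_centralizer[OF gR]] subsetI CollectI conjI ballI)
    fix s r assume s: "s \<in> S" and r: "r \<in> generate G R"
    with \<open>generate G R \<subseteq> ?C S\<close> have "r \<otimes> s = s \<otimes> r" by blast
    then show "s \<otimes> r = r \<otimes> s" by (rule sym)
  qed (use assms(1) in blast)
  then have "s \<otimes> r = r \<otimes> s" using assms(4,5) by blast
  then show ?thesis by (rule sym)
qed

lemma group_center_normal: "group_center G \<lhd> G"
  unfolding normal_inv_iff
proof (intro conjI ballI)
  show "subgroup (group_center G) G"
    unfolding group_center_def by (rule subgroup_centralizer) simp
  fix g z assume g: "g \<in> carrier G" and z: "z \<in> group_center G"
  have zG: "z \<in> carrier G" and "g \<otimes> z = z \<otimes> g" using z g by (auto simp: group_center_def)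
  then have "g \<otimes> z \<otimes> inv g = z" using conj_fixed_iff_commute[OF g zG] by simp
  then show "g \<otimes> z \<otimes> inv g \<in> group_center G" using z by simp
qed

subsection \<open>Complements\<close>

lemma perm_complement_subgroup: "perm_complement G H K \<Longrightarrow> subgroup K G"
  by (simp add: perm_complement_def)

lemma perm_complement_Int: "\<lbrakk>perm_complement G H K; x \<in> H; x \<in> K\<rbrakk> \<Longrightarrow> x = \<one>"
  by (auto simp add: perm_complement_def)

text \<open>Dedekind's modular law for elements: in \<open>l = h \<otimes> k\<close> the factor
  \<open>k\<close> stays in \<open>L\<close>, because \<open>h\<close> already lies there.\<close>

lemma perm_complement_decomp:
  assumes "perm_complement G H K" "subgroup H G" "subgroup L G" "H \<subseteq> L" "l \<in> L"
  obtains h k where "h \<in> H" "k \<in> K" "k \<in> L" "l = h \<otimes> k"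
proof -
  have lG: "l \<in> carrier G" using subgroup.mem_carrier[OF assms(3,5)] .
  then have "l \<in> H <#> K"
    using assms(1) by (simp add: perm_complement_def)
  then obtain h k where hk: "h \<in> H" "k \<in> K" "l = h \<otimes> k"
    unfolding set_mult_def by blast
  have hG: "h \<in> carrier G" "k \<in> carrier G"
    using subgroup.mem_carrier[OF assms(2) hk(1)]
      subgroup.mem_carrier[OF perm_complement_subgroup[OF assms(1)] hk(2)] .
  have "h \<in> L" using hk(1) assms(4) by blast
  then have "inv h \<otimes> l \<in> L"
    using assms(3,5) by (simp add: subgroup.m_closed subgroup.m_inv_closed)
  then have "k \<in> L" using hG hk(3) by (simp add: l_inv_cancel)
  with hk show ?thesis using that by blast
qed

lemma perm_complementI:
  assumes "subgroup H G" "subgroup K G" "\<And>g. g \<in> carrier G \<Longrightarrow> \<exists>h\<in>H. \<exists>k\<in>K. g = h \<otimes> k"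
    and "\<And>x. \<lbrakk>x \<in> H; x \<in> K\<rbrakk> \<Longrightarrow> x = \<one>"
  shows "perm_complement G H K"
proof -
  have "carrier G \<subseteq> H <#> K"
    using assms(3) unfolding set_mult_def by blast
  moreover have "H <#> K \<subseteq> carrier G"
    using setmult_subset_G[OF subgroup.subset[OF assms(1)] subgroup.subset[OF assms(2)]] .
  moreover have "\<one> \<in> H" "\<one> \<in> K"
    using subgroup.one_closed[OF assms(1)] subgroup.one_closed[OF assms(2)] .
  ultimately show ?thesis
    using assms(2,4) unfolding perm_complement_def by blast
qed

lemma perm_complement_Int_subgroup:
  assumes L: "subgroup L G" and H: "subgroup H G" "H \<subseteq> L" and K: "perm_complement G H K"
  shows "perm_complement (G\<lparr>carrier := L\<rparr>) H (K \<inter> L)"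
proof -
  interpret L: group "G\<lparr>carrier := L\<rparr>" using L by (rule subgroup_imp_group)
  show ?thesis
  proof (rule L.perm_complementI)
    show "subgroup H (G\<lparr>carrier := L\<rparr>)" by (rule subgroup_incl[OF H(1) L H(2)])
    show "subgroup (K \<inter> L) (G\<lparr>carrier := L\<rparr>)"
      using L K by (simp add: perm_complement_subgroup subgroup_incl subgroups_Inter_pair)
    show "\<exists>h\<in>H. \<exists>k\<in>K \<inter> L. g = h \<otimes>\<^bsub>G\<lparr>carrier := L\<rparr>\<^esub> k"
      if "g \<in> carrier (G\<lparr>carrier := L\<rparr>)" for g
      using that perm_complement_decomp[OF K H(1) L H(2), of g] by simp blast
  qed (use K perm_complement_Int in auto)
qed

text \<open>Complements in \<open>G\<close> are cut down to \<open>L\<close> by the modular law.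
  Only subgroups of \<open>L\<close> are asked to have complements, so that a finite
  \<open>L\<close> in a profinite C-group qualifies.\<close>

lemma C_group_subgroup:
  assumes L: "subgroup L G"
    and compl: "\<And>H. \<lbrakk>subgroup H G; H \<subseteq> L\<rbrakk> \<Longrightarrow> \<exists>K. perm_complement G H K"
  shows "C_group (G\<lparr>carrier := L\<rparr>)"
  unfolding C_group_def
proof (intro allI impI)
  fix H assume H: "subgroup H (G\<lparr>carrier := L\<rparr>)"
  then have HL: "H \<subseteq> L" using subgroup.subset[OF H] by simp
  have HG: "subgroup H G" using incl_subgroup[OF L H] .
  obtain K where "perm_complement G H K" using compl HG HL by blast
  then show "\<exists>K. perm_complement (G\<lparr>carrier := L\<rparr>) H K"
    using perm_complement_Int_subgroup[OF L HG HL] by blast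
qed

text \<open>\<open>G\<close> is the product of \<open>H\<close> and \<open>K\<close>. Here
  \<open>H\<close> centralizes \<open>K \<inter> A\<close> because \<open>A\<close> is abelian and
  contains \<open>H\<close>, while \<open>K\<close> normalizes \<open>K \<inter> A\<close> because
  \<open>A\<close> is normal.\<close>

lemma complement_Int_normal:
  assumes A: "\<And>x y. \<lbrakk>x \<in> A; y \<in> A\<rbrakk> \<Longrightarrow> x \<otimes> y = y \<otimes> x"
    and AG: "A \<lhd> G" and H: "subgroup H G" "H \<subseteq> A" and K: "perm_complement G H K"
  shows "K \<inter> A \<lhd> G"
  unfolding normal_inv_iff
proof (intro conjI ballI)
  interpret A: normal A G by (rule AG)
  have KG: "subgroup K G" using K by (rule perm_complement_subgroup)
  interpret K: subgroup K G by (rule KG)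
  show "subgroup (K \<inter> A) G" using KG A.subgroup_axioms by (rule subgroups_Inter_pair)
  fix g x assume g: "g \<in> carrier G" and x: "x \<in> K \<inter> A"
  obtain h k where hk: "h \<in> H" "k \<in> K" "g = h \<otimes> k"
    using perm_complement_decomp[OF K H(1) subgroup_self subgroup.subset[OF H(1)] g] .
  have hA: "h \<in> A" using hk H by blast
  have y: "k \<otimes> x \<otimes> inv k \<in> K \<inter> A"
    using hk x A.inv_op_closed2 by auto
  have "g \<otimes> x \<otimes> inv g = h \<otimes> (k \<otimes> x \<otimes> inv k) \<otimes> inv h"
    using hk hA x by (simp add: group_normalize)
  also have "\<dots> = k \<otimes> x \<otimes> inv k"
    using A[OF hA, of "k \<otimes> x \<otimes> inv k"] hA y
    by (metis A.mem_carrier Int_iff conj_fixed_iff_commute)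
  finally show "g \<otimes> x \<otimes> inv g \<in> K \<inter> A" using y by simp
qed

section \<open>Elements of prime order\<close>

lemma ex_prime_ord_pow:
  assumes x: "x \<in> carrier G" "x \<noteq> \<one>" "ord x \<noteq> 0"
  obtains k :: nat where "Factorial_Ring.prime (ord (x [^] k))"
proof -
  have "ord x \<noteq> 1" using x ord_eq_1 by simp
  then obtain p where p: "Factorial_Ring.prime p" "p dvd ord x" using prime_factor_nat by blast
  then obtain k where k: "ord x = p * k" by blast
  have "k \<noteq> 0" using k x(3) by auto
  then have "ord (x [^] k) = p" using ord_pow[OF x(1), of k] k by simp
  then show ?thesis using p by (intro that[of k]) simp
qed

text \<open>Bezout: if \<open>y\<close> is the power of \<open>x\<close> with exponent
  \<open>i\<close>, then \<open>i\<close> is invertible modulo the prime \<open>ord x\<close>, so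
  \<open>x\<close> is a power of \<open>y\<close>.\<close>

lemma prime_ord_generate:
  assumes x: "x \<in> carrier G" "Factorial_Ring.prime (ord x)" and y: "y \<in> generate G {x}" "y \<noteq> \<one>"
  shows "x \<in> generate G {y}"
proof -
  obtain i :: int where i: "y = x [^] i" using y(1) generate_pow[OF x(1)] by blast
  have "\<not> int (ord x) dvd i" using i y(2) int_pow_eq_id[OF x(1)] by simp
  then have "coprime (int (ord x)) i" using x(2) prime_imp_coprime[of "int (ord x)" i] by simp
  then obtain a b where ab: "a * int (ord x) + b * i = 1"
    using bezout_int[of "int (ord x)" i] by auto
  have "x = x [^] (a * int (ord x) + b * i)" unfolding ab using x by simp
  also have "\<dots> = x [^] (a * int (ord x)) \<otimes> x [^] (b * i)"
    using int_pow_mult[OF x(1)] .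
  also have "x [^] (a * int (ord x)) = \<one>" using x by (simp add: int_pow_eq_id)
  also have "x [^] (b * i) = y [^] b" using int_pow_pow[OF x(1), of i b] i by (simp add: mult.commute)
  finally have "x = \<one> \<otimes> y [^] b" .
  then have "x = y [^] b" using x i by (metis int_pow_closed l_one)
  moreover have "y \<in> carrier G" using x i by simp
  ultimately show ?thesis using generate_pow[of y] by blast
qed

subsection \<open>Eigenelements\<close>

text \<open>Such an \<open>a\<close> spans a one-dimensional invariant subspace over a prime field:
  conjugation multiplies exponents by a scalar, so \<open>a\<close> is a common eigenvector of
  \<open>G\<close>. Invariance is required on the generator and passes to its powers by
  \<open>conj_int_pow\<close>.\<close>

definition eigenelements :: "'a set" where
  "eigenelements = {a \<in> carrier G. Factorial_Ring.prime (ord a) \<and>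
     (\<forall>g\<in>carrier G. g \<otimes> a \<otimes> inv g \<in> generate G {a})}"

lemma eigenelements_subset: "eigenelements \<subseteq> carrier G"
  by (auto simp: eigenelements_def)

text \<open>A complement \<open>K\<close> of the subgroup \<open>S\<close> generated by the
  eigenelements in \<open>A\<close> cuts out a normal subgroup \<open>K \<inter> A\<close>. If this
  were non-trivial, it would contain an eigenelement, which would also lie in
  \<open>S\<close>.\<close>

lemma abelian_normal_generated_by_eigenelements:
  assumes AG: "A \<lhd> G" and comm: "\<And>x y. \<lbrakk>x \<in> A; y \<in> A\<rbrakk> \<Longrightarrow> x \<otimes> y = y \<otimes> x"
    and tors: "\<And>x. x \<in> A \<Longrightarrow> ord x \<noteq> 0"
    and compl: "\<And>H. \<lbrakk>subgroup H G; H \<subseteq> A\<rbrakk> \<Longrightarrow> \<exists>K. perm_complement G H K"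
  shows "A \<subseteq> generate G (A \<inter> eigenelements)"
proof -
  define S where "S = generate G (A \<inter> eigenelements)"
  interpret A: normal A G by (rule AG)
  have AS: "subgroup A G" by (rule A.subgroup_axioms)
  have SG: "subgroup S G" unfolding S_def
    by (rule generate_is_subgroup) (use A.subset in blast)
  have SA: "S \<subseteq> A" unfolding S_def
    by (rule generate_subgroup_incl[OF _ AS]) blast
  obtain K where K: "perm_complement G S K" using compl[OF SG SA] by blast
  have TG: "K \<inter> A \<lhd> G" by (rule complement_Int_normal[OF comm AG SG SA K])
  interpret T: normal "K \<inter> A" G by (rule TG)
  have TS: "subgroup (K \<inter> A) G" by (rule T.subgroup_axioms)
  have triv: "K \<inter> A = {\<one>}"
  proof (rule ccontr)
    assume "K \<inter> A \<noteq> {\<one>}"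
    then obtain y0 where y0: "y0 \<in> K \<inter> A" "y0 \<noteq> \<one>" using T.one_closed by blast
    then obtain k :: nat where k: "Factorial_Ring.prime (ord (y0 [^] k))"
      using ex_prime_ord_pow[of y0] tors[of y0] A.mem_carrier by blast
    define y where "y = y0 [^] k"
    have y: "y \<in> K \<inter> A" "Factorial_Ring.prime (ord y)"
      using subgroup_int_pow_closed[OF TS y0(1), of "int k"] k by (auto simp: y_def int_pow_int)
    have yG: "y \<in> carrier G" using y by simp
    have y1: "y \<noteq> \<one>" using y(2) by auto
    define Y where "Y = generate G {y}"
    have YG: "subgroup Y G" unfolding Y_def by (rule generate_is_subgroup) (use yG in simp)
    have YT: "Y \<subseteq> K \<inter> A" unfolding Y_def
      by (rule generate_subgroup_incl[OF _ TS]) (use y in simp)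
    have yY: "y \<in> Y" unfolding Y_def by (simp add: generate.incl)
    obtain K' where K': "perm_complement G Y K'" using compl[OF YG] YT by blast
    have NG: "K' \<inter> A \<lhd> G" by (rule complement_Int_normal[OF comm AG YG _ K']) (use YT in auto)
    \<comment> \<open>\<open>Y\<close> need not be normal, so \<open>y\<close> may fail to be an
      eigenelement. But its complement \<open>M\<close> in \<open>K \<inter> A\<close> is normal,
      and a complement of \<open>M\<close> there is normal as well and has the same prime order as
      \<open>Y\<close>.\<close>
    define M where "M = (K' \<inter> A) \<inter> (K \<inter> A)"
    have MG: "M \<lhd> G" unfolding M_def by (rule normal_subgroup_intersect[OF NG TG])
    interpret M: normal M G by (rule MG)
    have MS: "subgroup M G" by (rule M.subgroup_axioms)
    have MT: "M \<subseteq> K \<inter> A" unfolding M_def by blast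
    obtain K'' where K'': "perm_complement G M K''" using compl[OF MS] MT by blast
    interpret K'': subgroup K'' G by (rule perm_complement_subgroup[OF K''])
    have DG: "K'' \<inter> (K \<inter> A) \<lhd> G"
      by (rule complement_Int_normal[OF _ TG MS MT K'']) (use comm in auto)
    \<comment> \<open>\<open>d\<close> is the image of \<open>y\<close> under the projection along
      \<open>M\<close>; it will generate \<open>K'' \<inter> (K \<inter> A)\<close>.\<close>
    obtain m d where md: "m \<in> M" "d \<in> K''" "d \<in> K \<inter> A" "y = m \<otimes> d"
      using perm_complement_decomp[OF K'' MS TS MT y(1)] .
    have cG: "m \<in> carrier G" "d \<in> carrier G" using md by auto
    have mdc: "m \<otimes> d = d \<otimes> m" using md MT comm by blast
    have d1: "d \<noteq> \<one>"
    proof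
      assume "d = \<one>"
      then have "y = m" using md cG by simp
      then have "y \<in> K'" using md(1) by (simp add: M_def)
      then show False using perm_complement_Int[OF K' yY] y1 by simp
    qed
    \<comment> \<open>The power of \<open>m\<close> is inverse to that of \<open>d\<close>, so the
      latter lies in both \<open>M\<close> and its complement.\<close>
    have "d [^] int (ord y) = \<one>"
    proof -
      have "\<one> = y [^] int (ord y)" using yG by (simp add: int_pow_int)
      also have "\<dots> = m [^] int (ord y) \<otimes> d [^] int (ord y)"
        unfolding md(4) using int_pow_mult_distrib[OF mdc cG] .
      finally have e: "inv (m [^] int (ord y)) = d [^] int (ord y)"
        using cG by (metis inv_closed inv_comm inv_equality int_pow_closed)
      have "inv (m [^] int (ord y)) \<in> M"
        by (rule M.m_inv_closed[OF subgroup_int_pow_closed[OF MS md(1)]])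
      then have "d [^] int (ord y) \<in> M" unfolding e .
      moreover have "d [^] int (ord y) \<in> K''"
        by (rule subgroup_int_pow_closed[OF K''.subgroup_axioms md(2)])
      ultimately show ?thesis by (rule perm_complement_Int[OF K''])
    qed
    then have "ord d dvd ord y" using int_pow_eq_id[OF cG(2), of "int (ord y)"] by simp
    moreover have "ord d \<noteq> 1" using d1 ord_eq_1[OF cG(2)] by simp
    ultimately have pd: "Factorial_Ring.prime (ord d)" using y(2) by (metis prime_nat_iff)
    \<comment> \<open>Modulo \<open>M\<close> every element of \<open>K \<inter> A\<close> is a
      power of \<open>y\<close>, hence of \<open>d\<close>; for \<open>e\<close> in the complement
      \<open>K''\<close> the remaining factor from \<open>M\<close> must be trivial.\<close>
    have D: "e \<in> generate G {d}" if e: "e \<in> K'' \<inter> (K \<inter> A)" for e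
    proof -
      have eT: "e \<in> K \<inter> A" using e by blast
      obtain u k where uk: "u \<in> Y" "k \<in> K'" "k \<in> K \<inter> A" "e = u \<otimes> k"
        using perm_complement_decomp[OF K' YG TS YT eT] .
      obtain i :: int where i: "u = y [^] i" using uk(1) generate_pow[OF yG] unfolding Y_def by blast
      have u: "u = m [^] i \<otimes> d [^] i" unfolding i md(4) using int_pow_mult_distrib[OF mdc cG] .
      have kM: "k \<in> M" using uk unfolding M_def by blast
      have miM: "m [^] i \<in> M" by (rule subgroup_int_pow_closed[OF MS md(1)])
      have diA: "d [^] i \<in> K \<inter> A" by (rule subgroup_int_pow_closed[OF TS md(3)])
      have diK: "d [^] i \<in> K''" by (rule subgroup_int_pow_closed[OF K''.subgroup_axioms md(2)])
      have cc: "m [^] i \<otimes> d [^] i = d [^] i \<otimes> m [^] i" using miM diA MT comm by blast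
      have "inv (d [^] i) \<otimes> e = m [^] i \<otimes> k"
        unfolding uk(4) u cc using cG kM by (simp add: group_normalize)
      moreover have "m [^] i \<otimes> k \<in> M" using miM kM by (rule M.m_closed)
      moreover have "inv (d [^] i) \<otimes> e \<in> K''" using diK e by simp
      ultimately have "inv (d [^] i) \<otimes> e = \<one>" using perm_complement_Int[OF K''] by simp
      then have "e = d [^] i" using cG eT
        by (metis inv_solve_left int_pow_closed one_closed r_one T.mem_carrier)
      then show ?thesis using generate_pow[OF cG(2)] by blast
    qed
    have "g \<otimes> d \<otimes> inv g \<in> generate G {d}" if "g \<in> carrier G" for g
      using D normal.inv_op_closed2[OF DG that, of d] md by blast
    then have "d \<in> eigenelements" using cG pd by (simp add: eigenelements_def)
    then have "d \<in> S" unfolding S_def using md(3) by (simp add: generate.incl)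
    then show False using perm_complement_Int[OF K, of d] md(3) d1 by blast
  qed
  show ?thesis
  proof
    fix a assume a: "a \<in> A"
    obtain s k where sk: "s \<in> S" "k \<in> K" "k \<in> A" "a = s \<otimes> k"
      using perm_complement_decomp[OF K SG AS SA a] .
    then have "k = \<one>" using triv by blast
    then show "a \<in> generate G (A \<inter> eigenelements)"
      using sk subgroup.mem_carrier[OF SG sk(1)] by (simp add: S_def)
  qed
qed

text \<open>Each conjugation acts on the cyclic group generated by \<open>a\<close> as a power map,
  and power maps commute. Hence commutators act trivially.\<close>

lemma derived_centralizes_eigenelement:
  assumes a: "a \<in> eigenelements" and d: "d \<in> derived G (carrier G)"
  shows "d \<otimes> a = a \<otimes> d"
proof -
  have aG: "a \<in> carrier G" using a by (simp add: eigenelements_def)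
  have pow: "\<exists>i::int. g \<otimes> a \<otimes> inv g = a [^] i" if "g \<in> carrier G" for g
    using a that generate_pow[OF aG] by (auto simp: eigenelements_def)
  have conj_comm: "g \<otimes> (h \<otimes> a \<otimes> inv h) \<otimes> inv g = h \<otimes> (g \<otimes> a \<otimes> inv g) \<otimes> inv h"
    if gh: "g \<in> carrier G" "h \<in> carrier G" for g h
  proof -
    obtain i j :: int where ij: "g \<otimes> a \<otimes> inv g = a [^] i" "h \<otimes> a \<otimes> inv h = a [^] j"
      using pow gh by metis
    show ?thesis
      by (simp add: ij aG gh conj_int_pow int_pow_pow mult.commute)
  qed
  let ?C = "{g \<in> carrier G. \<forall>s\<in>{a}. g \<otimes> s = s \<otimes> g}"
  have "derived_set G (carrier G) \<subseteq> ?C"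
  proof
    fix c assume "c \<in> derived_set G (carrier G)"
    then obtain g h where gh: "g \<in> carrier G" "h \<in> carrier G" and c: "c = g \<otimes> h \<otimes> inv g \<otimes> inv h"
      by blast
    have "c \<otimes> a \<otimes> inv c = g \<otimes> (h \<otimes> (inv g \<otimes> (inv h \<otimes> a \<otimes> inv (inv h)) \<otimes> inv (inv g)) \<otimes> inv h) \<otimes> inv g"
      unfolding c using gh aG by (simp add: m_assoc inv_mult_group)
    also have "\<dots> = g \<otimes> (h \<otimes> (inv h \<otimes> (inv g \<otimes> a \<otimes> inv (inv g)) \<otimes> inv (inv h)) \<otimes> inv h) \<otimes> inv g"
      using conj_comm[of "inv g" "inv h"] gh by simp
    also have "\<dots> = a" using gh aG by (simp add: group_normalize)
    finally have "c \<otimes> a = a \<otimes> c" using c gh aG by (subst (asm) conj_fixed_iff_commute) auto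
    then show "c \<in> ?C" using c gh by simp
  qed
  then have "derived G (carrier G) \<subseteq> ?C" unfolding derived_def
    by (rule generate_subgroup_incl[OF _ subgroup_centralizer]) (use aG in simp)
  then show ?thesis using d by blast
qed

lemma derived_centralizes_generated_by_eigenelements:
  assumes "x \<in> generate G (A \<inter> eigenelements)" and "d \<in> derived G (carrier G)"
  shows "d \<otimes> x = x \<otimes> d"
proof -
  have S: "subgroup (derived G (carrier G)) G" by (rule derived_is_subgroup) simp
  have "generate G (derived G (carrier G)) = derived G (carrier G)"
    using generate_subgroup_incl[OF _ S] by (auto intro: generate.incl)
  then show ?thesis
    using assms eigenelements_subset derived_centralizes_eigenelement
      generate_centralizes[of "A \<inter> eigenelements" "derived G (carrier G)" d x]
      subgroup.subset[OF S] by auto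
qed

subsection \<open>Finite C-groups\<close>

lemma subset_set_mult_left:
  assumes "H \<subseteq> carrier G" "\<one> \<in> K"
  shows "H \<subseteq> H <#> K"
proof
  fix h assume h: "h \<in> H"
  then have "h = h \<otimes> \<one>" using assms(1) by auto
  then show "h \<in> H <#> K" using h assms(2) unfolding set_mult_def by blast
qed

lemma subset_set_mult_right:
  assumes "K \<subseteq> carrier G" "\<one> \<in> H"
  shows "K \<subseteq> H <#> K"
proof
  fix k assume k: "k \<in> K"
  then have "k = \<one> \<otimes> k" using assms(1) by auto
  then show "k \<in> H <#> K" using k assms(2) unfolding set_mult_def by blast
qed

text \<open>A variant of the fact that a subgroup whose index is the least prime divisor of the
  group order is normal; \<open>K\<close> has index \<open>ord x\<close>. As \<open>ord\<close> is 0
  for elements of infinite order, \<open>min\<close> together with \<open>ord x \<noteq> 0\<close>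
  rules those out.\<close>

lemma complement_of_minimal_order_normal:
  assumes C: "C_group G" and x: "x \<in> carrier G" "ord x \<noteq> 0"
    and min: "\<And>y. \<lbrakk>y \<in> carrier G; y \<noteq> \<one>\<rbrakk> \<Longrightarrow> ord x \<le> ord y"
    and K: "perm_complement G (generate G {x}) K"
  shows "K \<lhd> G"
proof -
  define Y where "Y = generate G {x}"
  have YG: "subgroup Y G" unfolding Y_def by (rule generate_is_subgroup) (use x in simp)
  have cardY: "card Y = ord x" unfolding Y_def using generate_pow_card[OF x(1)] by simp
  then have finY: "finite Y" using x(2) card.infinite by fastforce
  have KY: "perm_complement G Y K" using K by (simp add: Y_def)
  have KG: "subgroup K G" by (rule perm_complement_subgroup[OF K])
  interpret K: subgroup K G by (rule KG)
  \<comment> \<open>A complement \<open>L\<close> of \<open>K \<inter> gKg\<inverse>\<close> meets \<open>K\<close> in fewer than \<open>ord x\<close> elements, since \<open>L \<inter> K\<close> embeds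
    into the cosets of \<open>K\<close> other than \<open>K\<close>; by minimality of \<open>ord x\<close> it meets \<open>K\<close> trivially.\<close>
  have key: "inv g \<otimes> k \<otimes> g \<in> K" if g: "g \<in> carrier G" "g \<notin> K" and k: "k \<in> K" for g k
  proof -
    define P where "P = {k \<in> K. inv g \<otimes> k \<otimes> g \<in> K}"
    have PG: "subgroup P G"
    proof (rule subgroupI)
      show "P \<subseteq> carrier G" unfolding P_def using K.subset by blast
      have "\<one> \<in> P" unfolding P_def using g by simp
      then show "P \<noteq> {}" by blast
      fix a assume a: "a \<in> P"
      then have "inv (inv g \<otimes> a \<otimes> g) \<in> K" unfolding P_def by blast
      moreover have "inv (inv g \<otimes> a \<otimes> g) = inv g \<otimes> inv a \<otimes> g"
        using a g unfolding P_def by (simp add: group_normalize)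
      ultimately show "inv a \<in> P" using a unfolding P_def by simp
      fix b assume b: "b \<in> P"
      have "(inv g \<otimes> a \<otimes> g) \<otimes> (inv g \<otimes> b \<otimes> g) \<in> K"
        using a b unfolding P_def by blast
      moreover have "(inv g \<otimes> a \<otimes> g) \<otimes> (inv g \<otimes> b \<otimes> g) = inv g \<otimes> (a \<otimes> b) \<otimes> g"
        using a b g unfolding P_def by (simp add: group_normalize)
      ultimately show "a \<otimes> b \<in> P" using a b unfolding P_def by simp
    qed
    have PK: "P \<subseteq> K" unfolding P_def by blast
    obtain L where L: "perm_complement G P L" using C PG unfolding C_group_def by blast
    have LG: "subgroup L G" by (rule perm_complement_subgroup[OF L])
    obtain p l where pl: "p \<in> P" "l \<in> L" "l \<in> K" "k = p \<otimes> l"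
      using perm_complement_decomp[OF L PG KG PK k] .
    have lG: "l \<in> carrier G" using pl(3) by simp
    have powK: "l [^] j \<in> K" and powL: "l [^] j \<in> L" for j :: nat
      using subgroup_int_pow_closed[OF KG pl(3), of "int j"]
        subgroup_int_pow_closed[OF LG pl(2), of "int j"] by (simp_all add: int_pow_int)
    have "l = \<one>"
    proof (rule ccontr)
      assume "l \<noteq> \<one>"
      then have ord_le: "ord x \<le> ord l" using min lG by blast
      \<comment> \<open>The left coset of \<open>K\<close> through
        \<open>l [^] j \<otimes> g\<close> is represented by an element of \<open>Y\<close>. It is
        never \<open>\<one>\<close>, because \<open>l [^] j\<close> lies in \<open>K\<close> and
        \<open>g\<close> does not.\<close>
      have "\<exists>y\<in>Y. \<exists>k\<in>K. l [^] j \<otimes> g = y \<otimes> k" for j :: nat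
        using perm_complement_decomp[OF KY YG subgroup_self subgroup.subset[OF YG], of "l [^] j \<otimes> g"]
          lG g(1) by blast
      then obtain f f' where f: "f j \<in> Y" "f' j \<in> K" "l [^] j \<otimes> g = f j \<otimes> f' j" for j :: nat
        by metis
      have f1: "f j \<noteq> \<one>" for j
      proof
        assume "f j = \<one>"
        then have "l [^] j \<otimes> g = f' j" using f[of j] by simp
        then have "g = inv (l [^] j) \<otimes> f' j"
          using lG g f(2)[of j] by (metis K.mem_carrier inv_solve_left nat_pow_closed)
        then have "g \<in> K" using powK[of j] f(2)[of j] by simp
        then show False using g by simp
      qed
      have "f ` {..<ord x} \<subseteq> Y - {\<one>}" using f(1) f1 by auto
      then have "card (f ` {..<ord x}) \<le> card (Y - {\<one>})" using finY by (intro card_mono) auto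
      also have "\<dots> < ord x"
        using cardY x(2) subgroup.one_closed[OF YG] finY by (simp add: card_Diff_singleton)
      \<comment> \<open>Pigeonhole: \<open>ord x\<close> exponents against \<open>ord x - 1\<close>
        non-trivial elements of \<open>Y\<close>.\<close>
      finally have "\<not> inj_on f {..<ord x}" using card_image[of f "{..<ord x}"] by auto
      then obtain i j where ij: "i < j" "j < ord x" "f i = f j"
        unfolding inj_on_def by (metis lessThan_iff linorder_neqE_nat)
      have fG: "f j \<in> carrier G" using subgroup.mem_carrier[OF YG f(1)] .
      have "inv (f' i) \<otimes> f' j = inv (l [^] i \<otimes> g) \<otimes> (l [^] j \<otimes> g)"
        unfolding f(3) ij(3) using fG f(2)[of i] f(2)[of j] by (simp add: group_normalize)
      also have "l [^] j = l [^] i \<otimes> l [^] (j - i)" using lG ij(1) by (simp add: nat_pow_mult)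
      also have "inv (l [^] i \<otimes> g) \<otimes> (l [^] i \<otimes> l [^] (j - i) \<otimes> g) = inv g \<otimes> l [^] (j - i) \<otimes> g"
        using lG g(1) by (simp add: group_normalize)
      finally have "inv g \<otimes> l [^] (j - i) \<otimes> g \<in> K" using f(2) by (metis K.m_closed K.m_inv_closed)
      then have "l [^] (j - i) \<in> P" unfolding P_def using powK by simp
      \<comment> \<open>The element lies in \<open>P\<close> and in its complement \<open>L\<close>,
        so it is trivial, although the exponent is positive and below
        \<open>ord x \<le> ord l\<close>.\<close>
      then have "l [^] (j - i) = \<one>" using perm_complement_Int[OF L] powL by simp
      then have "ord l dvd j - i" using pow_eq_id[OF lG] by simp
      then show False using ij ord_le by (auto dest!: dvd_imp_le)
    qed
    then have "k \<in> P" using pl(1,4) subgroup.mem_carrier[OF PG pl(1)] by simp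
    then show ?thesis unfolding P_def by blast
  qed
  show ?thesis unfolding normal_inv_iff
  proof (intro conjI ballI KG)
    fix g k assume g: "g \<in> carrier G" and k: "k \<in> K"
    show "g \<otimes> k \<otimes> inv g \<in> K"
    proof (cases "inv g \<in> K")
      case True
      then have "g \<in> K" using g K.m_inv_closed by fastforce
      then show ?thesis using k by simp
    next
      case False
      then show ?thesis using key[of "inv g" k] g k by simp
    qed
  qed
qed

text \<open>Every coset of \<open>K\<close> is represented by a power of \<open>x\<close>, so
  \<open>G Mod K\<close> is abelian.\<close>

lemma derived_subset_of_cyclic_complement:
  assumes x: "x \<in> carrier G" and K: "perm_complement G (generate G {x}) K" and KN: "K \<lhd> G"
  shows "derived G (carrier G) \<subseteq> K"
proof (rule derived_minimal[OF KN])
  interpret K: normal K G by (rule KN)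
  interpret Q: group "G Mod K" by (rule K.factorgroup_is_group)
  have YG: "subgroup (generate G {x}) G" by (rule generate_is_subgroup) (use x in simp)
  have rep: "\<exists>y\<in>generate G {x}. R = K #> y" if R: "R \<in> rcosets K" for R
  proof -
    obtain g where g: "g \<in> carrier G" "R = K #> g" using R unfolding RCOSETS_def by blast
    obtain y k where yk: "y \<in> generate G {x}" "k \<in> K" "g = y \<otimes> k"
      using perm_complement_decomp[OF K YG subgroup_self subgroup.subset[OF YG] g(1)] .
    have yG: "y \<in> carrier G" by (rule subgroup.mem_carrier[OF YG yk(1)])
    have "g = (y \<otimes> k \<otimes> inv y) \<otimes> y" using yk yG by (simp add: group_normalize)
    then have "g \<in> K #> y"
      using K.inv_op_closed2[OF yG yk(2)] unfolding r_coset_def by blast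
    from repr_independence[OF this yG K.subgroup_axioms] show ?thesis using yk(1) g(2) by blast
  qed
  show "comm_group (G Mod K)"
  proof (rule Q.group_comm_groupI)
    fix R S assume "R \<in> carrier (G Mod K)" "S \<in> carrier (G Mod K)"
    then obtain y z where yz: "y \<in> generate G {x}" "R = K #> y" "z \<in> generate G {x}" "S = K #> z"
      using rep by (metis FactGroup_def partial_object.select_convs(1))
    have c: "y \<in> carrier G" "z \<in> carrier G" using yz subgroup.mem_carrier[OF YG] by blast+
    have "y \<otimes> z = z \<otimes> y" using generate_centralizes[of "{x}" "{x}" y z] x yz by simp
    then show "R \<otimes>\<^bsub>G Mod K\<^esub> S = S \<otimes>\<^bsub>G Mod K\<^esub> R"
      using yz c by (simp add: FactGroup_def K.rcos_sum)
  qed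
qed

section \<open>Finite C-groups are metabelian\<close>

lemma commutator_eq_one_imp_commute:
  assumes "x \<in> carrier G" "y \<in> carrier G" "x \<otimes> y \<otimes> inv x \<otimes> inv y = \<one>"
  shows "x \<otimes> y = y \<otimes> x"
proof -
  have "x \<otimes> y = (x \<otimes> y \<otimes> inv x \<otimes> inv y) \<otimes> (y \<otimes> x)"
    using assms(1,2) by (simp add: group_normalize)
  also have "\<dots> = y \<otimes> x" unfolding assms(3) using assms(1,2) by simp
  finally show ?thesis .
qed

text \<open>With \<open>z\<close> of least order, its normal complement \<open>K\<close> contains
  the derived subgroup \<open>D\<close>, so by induction the second derived subgroup
  \<open>A\<close> is abelian and then centralized by \<open>D\<close>. A complement of
  \<open>A\<close> turns out to contain all commutators of \<open>D\<close>, which forces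
  \<open>A\<close> to be trivial. The statement is about commutators;
  \<open>generate_centralizes\<close> extends it to the subgroup they generate.\<close>

lemma finite_C_group_commutators_commute_step:
  assumes fin: "finite (carrier G)" and C: "C_group G"
    and IH: "\<And>K u v. \<lbrakk>subgroup K G; K \<subset> carrier G; u \<in> derived_set G K; v \<in> derived_set G K\<rbrakk>
               \<Longrightarrow> u \<otimes> v = v \<otimes> u"
    and xy_comm: "x \<in> derived_set G (carrier G)" "y \<in> derived_set G (carrier G)"
  shows "x \<otimes> y = y \<otimes> x"
proof (cases "carrier G = {\<one>}")
  case True
  have "x \<in> carrier G" "y \<in> carrier G"
    using xy_comm[THEN set_mp[OF derived_set_in_carrier[OF subset_refl]]] .
  then have "x = y" unfolding True by simp
  then show ?thesis by simp
next
  case False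
  obtain g0 where g0: "g0 \<in> carrier G \<and> g0 \<noteq> \<one>"
  proof (rule ccontr)
    assume "\<not> thesis"
    then have "carrier G \<subseteq> {\<one>}" using that by blast
    then show False using False one_closed by (simp add: subset_singleton_iff)
  qed
  obtain z where z': "z \<in> carrier G \<and> z \<noteq> \<one>"
    and min': "\<forall>g. g \<in> carrier G \<and> g \<noteq> \<one> \<longrightarrow> ord z \<le> ord g"
    using ex_has_least_nat[of "\<lambda>g. g \<in> carrier G \<and> g \<noteq> \<one>" g0 ord, OF g0]
    by (elim exE conjE) (rule that, simp_all)
  have z: "z \<in> carrier G" "z \<noteq> \<one>" using z' by simp_all
  have min: "ord z \<le> ord g" if "g \<in> carrier G" "g \<noteq> \<one>" for g using min' that by simp
  have tors: "ord g \<noteq> 0" if "g \<in> carrier G" for g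
    using ord_ge_1[OF fin that] by simp
  have "subgroup (generate G {z}) G" by (rule generate_is_subgroup) (use z in simp)
  then obtain K where K: "perm_complement G (generate G {z}) K"
    using C unfolding C_group_def by blast
  have KN: "K \<lhd> G"
    by (rule complement_of_minimal_order_normal[OF C z(1) tors[OF z(1)] min K])
  have KG: "subgroup K G" by (rule perm_complement_subgroup[OF K])
  have zK: "z \<notin> K" using perm_complement_Int[OF K] z by (meson generate.incl singletonI)
  have "K \<subset> carrier G" using subgroup.subset[OF KG] z zK by blast
  then have commK: "u \<otimes> v = v \<otimes> u" if "u \<in> derived_set G K" "v \<in> derived_set G K" for u v
    using IH[OF KG] that by blast
  define D where "D = derived G (carrier G)"
  define A where "A = derived G D"
  have DN: "D \<lhd> G" unfolding D_def by (rule derived_self_is_normal)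
  have AN: "A \<lhd> G" unfolding A_def by (rule derived_is_normal[OF DN])
  interpret D: normal D G by (rule DN)
  interpret A: normal A G by (rule AN)
  have DK: "D \<subseteq> K" unfolding D_def by (rule derived_subset_of_cyclic_complement[OF z(1) K KN])
  have AD: "A \<subseteq> D" unfolding A_def by (rule derived_incl[OF _ D.subgroup_axioms]) simp
  have dsD: "derived_set G D \<subseteq> carrier G" by (rule derived_set_in_carrier[OF D.subset])
  \<comment> \<open>\<open>A\<close> is generated by commutators of elements of
    \<open>D \<subseteq> K\<close>, and the induction hypothesis applies to those.\<close>
  have commA: "u \<otimes> v = v \<otimes> u" if "u \<in> A" "v \<in> A" for u v
  proof (rule generate_centralizes[OF dsD dsD])
    show "u \<in> generate G (derived_set G D)" "v \<in> generate G (derived_set G D)"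
      using that unfolding A_def derived_def .
  qed (rule commK; erule set_mp[OF mono_derived_set[OF DK]])
  have Agen: "A \<subseteq> generate G (A \<inter> eigenelements)"
  proof (rule abelian_normal_generated_by_eigenelements[OF AN commA])
    show "ord u \<noteq> 0" if "u \<in> A" for u using tors A.mem_carrier[OF that] by blast
    show "\<exists>K. perm_complement G H K" if "subgroup H G" for H
      using C that by (simp add: C_group_def)
  qed
  have central: "d \<otimes> a = a \<otimes> d" if "d \<in> D" "a \<in> A" for d a
    using derived_centralizes_generated_by_eigenelements[of a A d] set_mp[OF Agen that(2)] that(1)
    unfolding D_def .
  obtain Q where Q: "perm_complement G A Q"
    using C A.subgroup_axioms unfolding C_group_def by blast
  interpret Q: subgroup Q G by (rule perm_complement_subgroup[OF Q])
  \<comment> \<open>Elements of \<open>D\<close> are split into factors from \<open>A\<close> and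
    \<open>Q\<close>. The factors from \<open>A\<close> are central in \<open>D\<close> and cancel
    from a commutator, which is thus the commutator of the \<open>Q\<close>-factors.\<close>
  have "derived_set G D \<subseteq> Q"
  proof
    fix c assume "c \<in> derived_set G D"
    then obtain u v where uv: "u \<in> D" "v \<in> D" and c: "c = u \<otimes> v \<otimes> inv u \<otimes> inv v" by blast
    obtain a q where aq: "a \<in> A" "q \<in> Q" "q \<in> D" "u = a \<otimes> q"
      using perm_complement_decomp[OF Q A.subgroup_axioms D.subgroup_axioms AD uv(1)] .
    obtain b r where br: "b \<in> A" "r \<in> Q" "r \<in> D" "v = b \<otimes> r"
      using perm_complement_decomp[OF Q A.subgroup_axioms D.subgroup_axioms AD uv(2)] .
    define w where "w = (q \<otimes> r) \<otimes> inv (r \<otimes> q)"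
    have w: "w \<in> D" "w \<in> Q" unfolding w_def using aq br by simp_all
    have cG: "a \<in> carrier G" "b \<in> carrier G" "q \<in> carrier G" "r \<in> carrier G"
      using aq br by simp_all
    have "u \<otimes> v = a \<otimes> (q \<otimes> b) \<otimes> r" unfolding aq(4) br(4) using cG by (simp add: m_assoc)
    also have "q \<otimes> b = b \<otimes> q" using central[OF aq(3) br(1)] .
    finally have 1: "u \<otimes> v = (a \<otimes> b) \<otimes> (q \<otimes> r)" using cG by (simp add: m_assoc)
    have "v \<otimes> u = b \<otimes> (r \<otimes> a) \<otimes> q" unfolding aq(4) br(4) using cG by (simp add: m_assoc)
    also have "r \<otimes> a = a \<otimes> r" using central[OF br(3) aq(1)] .
    finally have "v \<otimes> u = (b \<otimes> a) \<otimes> (r \<otimes> q)" using cG by (simp add: m_assoc)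
    then have 2: "v \<otimes> u = (a \<otimes> b) \<otimes> (r \<otimes> q)" using commA[OF aq(1) br(1)] by simp
    have "c = (u \<otimes> v) \<otimes> inv (v \<otimes> u)" unfolding c using uv by (simp add: group_normalize)
    also have "\<dots> = (a \<otimes> b) \<otimes> w \<otimes> inv (a \<otimes> b)"
      unfolding 1 2 w_def using cG by (simp add: group_normalize)
    also have "\<dots> = w"
      using central[OF w(1), of "a \<otimes> b"] aq(1) br(1) w(1) cG
      by (simp add: conj_fixed_iff_commute)
    finally show "c \<in> Q" using w by simp
  qed
  then have AQ: "A \<subseteq> Q" unfolding A_def derived_def
    by (rule generate_subgroup_incl[OF _ Q.subgroup_axioms])
  have xy: "x \<in> D" "y \<in> D" unfolding D_def derived_def
    using xy_comm[THEN generate.incl] .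
  have "x \<otimes> y \<otimes> inv x \<otimes> inv y \<in> derived_set G D" using xy by blast
  then have "x \<otimes> y \<otimes> inv x \<otimes> inv y \<in> A" unfolding A_def derived_def by (rule generate.incl)
  then have "x \<otimes> y \<otimes> inv x \<otimes> inv y = \<one>" using AQ perm_complement_Int[OF Q] by blast
  then show ?thesis
    by (rule commutator_eq_one_imp_commute[OF D.mem_carrier[OF xy(1)] D.mem_carrier[OF xy(2)]])
qed

end

text \<open>Strong induction on the group order, outside the group context because the induction
  hypothesis is applied to proper subgroups as groups of their own.\<close>

lemma finite_C_group_commutators_commute:
  assumes "group G" "finite (carrier G)" "C_group G"
    and "x \<in> derived_set G (carrier G)" "y \<in> derived_set G (carrier G)"
  shows "x \<otimes>\<^bsub>G\<^esub> y = y \<otimes>\<^bsub>G\<^esub> x"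
  using assms
proof (induction "card (carrier G)" arbitrary: G x y rule: less_induct)
  case less
  note fin = less.prems(2) and C = less.prems(3)
  show ?case
  proof (rule group.finite_C_group_commutators_commute_step[OF less.prems(1) fin C _ less.prems(4,5)])
    fix K u v assume K: "subgroup K G" "K \<subset> carrier G" and uv: "u \<in> derived_set G K" "v \<in> derived_set G K"
    have "card K < card (carrier G)" by (rule psubset_card_mono[OF fin K(2)])
    moreover have "C_group (G\<lparr>carrier := K\<rparr>)"
      using C group.C_group_subgroup[OF less.prems(1) K(1)] unfolding C_group_def[of G] by blast
    moreover have "finite K" by (rule finite_subset[OF subgroup.subset[OF K(1)] fin])
    moreover have "derived_set (G\<lparr>carrier := K\<rparr>) K = derived_set G K"
      by (rule group.derived_set_consistent[OF less.prems(1) subset_refl K(1)])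
    ultimately show "u \<otimes>\<^bsub>G\<^esub> v = v \<otimes>\<^bsub>G\<^esub> u"
      using less.hyps[of "G\<lparr>carrier := K\<rparr>" u v] group.subgroup_imp_group[OF less.prems(1) K(1)] uv
      by simp
  qed
qed

context group
begin

subsection \<open>Abstract C-groups\<close>

text \<open>\<open>W\<close> serves as a complement of \<open>H \<inter> A\<close> in
  \<open>A\<close> that is normal in \<open>G\<close>; being normal, it may be multiplied by any
  subgroup of \<open>B\<close>. \<open>B\<close> contributes a complement \<open>F\<close> of its
  part \<open>R\<close> lying in \<open>A <#> H\<close>.\<close>

lemma C_group_if_generated_by_eigenelements:
  assumes AN: "A \<lhd> G" and Agen: "A \<subseteq> generate G (A \<inter> eigenelements)"
    and B: "perm_complement G A B" and BC: "C_group (G\<lparr>carrier := B\<rparr>)"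
  shows "C_group G"
  unfolding C_group_def
proof (intro allI impI)
  fix H assume HG: "subgroup H G"
  interpret A: normal A G by (rule AN)
  interpret H: subgroup H G by (rule HG)
  have BG: "subgroup B G" by (rule perm_complement_subgroup[OF B])
  define \<W> where "\<W> = {W. W \<lhd> G \<and> W \<subseteq> A \<and> W \<inter> H \<subseteq> {\<one>}}"
  have "{\<one>} \<in> \<W>" unfolding \<W>_def using one_is_normal by simp
  then have ne: "\<W> \<noteq> {}" by blast
  have "\<Union>\<C> \<in> \<W>" if C: "\<C> \<noteq> {}" "subset.chain \<W> \<C>" for \<C>
  proof -
    have CW: "W \<lhd> G" "W \<subseteq> A" "W \<inter> H \<subseteq> {\<one>}" if "W \<in> \<C>" for W
      using C(2) that unfolding subset.chain_def \<W>_def by auto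
    have sub: "subgroup W G" if "W \<in> \<C>" for W using CW(1)[OF that] by (rule normal_imp_subgroup)
    have "subgroup (\<Union>\<C>) G"
    proof (rule subgroupI)
      show "\<Union>\<C> \<subseteq> carrier G" using sub subgroup.subset by blast
      obtain W where W: "W \<in> \<C>" using C(1) by blast
      then show "\<Union>\<C> \<noteq> {}" using subgroup.one_closed[OF sub[OF W]] by blast
      fix a assume "a \<in> \<Union>\<C>"
      then obtain V where V: "V \<in> \<C>" "a \<in> V" by blast
      then show "inv a \<in> \<Union>\<C>" using subgroup.m_inv_closed[OF sub[OF V(1)] V(2)] by blast
      fix b assume "b \<in> \<Union>\<C>"
      then obtain V' where V': "V' \<in> \<C>" "b \<in> V'" by blast
      have "V \<subseteq> V' \<or> V' \<subseteq> V" using C(2) V V' unfolding subset_chain_def by blast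
      then show "a \<otimes> b \<in> \<Union>\<C>"
      proof
        assume "V \<subseteq> V'"
        then have "a \<otimes> b \<in> V'" using subgroup.m_closed[OF sub[OF V'(1)]] V V' by blast
        then show ?thesis using V' by blast
      next
        assume "V' \<subseteq> V"
        then have "a \<otimes> b \<in> V" using subgroup.m_closed[OF sub[OF V(1)]] V V' by blast
        then show ?thesis using V by blast
      qed
    qed
    moreover have "g \<otimes> a \<otimes> inv g \<in> \<Union>\<C>" if "g \<in> carrier G" "a \<in> \<Union>\<C>" for g a
      using that CW(1) normal.inv_op_closed2 by (metis UnionE UnionI)
    ultimately have "\<Union>\<C> \<lhd> G" unfolding normal_inv_iff by blast
    then show ?thesis unfolding \<W>_def using CW(2,3) by blast
  qed
  from subset_Zorn_nonempty[OF ne this]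
  obtain W where W: "W \<in> \<W>" and max: "\<And>V. \<lbrakk>V \<in> \<W>; W \<subseteq> V\<rbrakk> \<Longrightarrow> V = W" by blast
  have WN: "W \<lhd> G" and WA: "W \<subseteq> A" and WH: "W \<inter> H \<subseteq> {\<one>}" using W unfolding \<W>_def by auto
  interpret W: normal W G by (rule WN)
  have MG: "subgroup (W <#> H) G" by (rule mult_norm_subgroup[OF WN HG])
  have W_M: "W \<subseteq> W <#> H" by (rule subset_set_mult_left[OF W.subset H.one_closed])
  \<comment> \<open>If an eigenelement \<open>a\<close> is outside \<open>W <#> H\<close>, then
    \<open>W\<close> enlarged by the normal subgroup generated by \<open>a\<close> is still a
    candidate, against the maximality of \<open>W\<close>.\<close>
  have "A \<inter> eigenelements \<subseteq> W <#> H"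
  proof (rule subsetI, rule ccontr)
    fix a assume a: "a \<in> A \<inter> eigenelements" and aM: "a \<notin> W <#> H"
    have aG: "a \<in> carrier G" using a by simp
    have pa: "Factorial_Ring.prime (ord a)" using a by (simp add: eigenelements_def)
    have agG: "subgroup (generate G {a}) G" by (rule generate_is_subgroup) (use aG in simp)
    define W' where "W' = W <#> generate G {a}"
    have "subgroup W' G" unfolding W'_def by (rule mult_norm_subgroup[OF WN agG])
    moreover have "g \<otimes> c \<otimes> inv g \<in> W'" if g: "g \<in> carrier G" and c: "c \<in> W'" for g c
    proof -
      obtain w e where we: "w \<in> W" "e \<in> generate G {a}" "c = w \<otimes> e"
        using c unfolding W'_def set_mult_def by blast
      obtain i :: int where i: "e = a [^] i" using we(2) generate_pow[OF aG] by blast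
      have "g \<otimes> a \<otimes> inv g \<in> generate G {a}" using a g by (simp add: eigenelements_def)
      then have "(g \<otimes> a \<otimes> inv g) [^] i \<in> generate G {a}" by (rule subgroup_int_pow_closed[OF agG])
      then have "g \<otimes> e \<otimes> inv g \<in> generate G {a}" using g aG i by (simp add: conj_int_pow)
      moreover have "g \<otimes> w \<otimes> inv g \<in> W" using W.inv_op_closed2[OF g we(1)] .
      moreover have "g \<otimes> c \<otimes> inv g = (g \<otimes> w \<otimes> inv g) \<otimes> (g \<otimes> e \<otimes> inv g)"
        unfolding we(3) using g we(1) i aG by (intro conj_mult) auto
      ultimately show ?thesis unfolding W'_def set_mult_def by blast
    qed
    ultimately have W'N: "W' \<lhd> G" unfolding normal_inv_iff by blast
    have "generate G {a} \<subseteq> A" by (rule generate_subgroup_incl[OF _ A.subgroup_axioms]) (use a in simp)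
    then have W'A: "W' \<subseteq> A" unfolding W'_def set_mult_def using WA by auto
    have W'H: "W' \<inter> H \<subseteq> {\<one>}"
    proof
      fix h assume h: "h \<in> W' \<inter> H"
      then obtain w e where we: "w \<in> W" "e \<in> generate G {a}" "h = w \<otimes> e"
        unfolding W'_def set_mult_def by blast
      have eG: "e \<in> carrier G" by (rule subgroup.mem_carrier[OF agG we(2)])
      \<comment> \<open>This puts \<open>e\<close> into \<open>W <#> H\<close>; a non-trivial
        \<open>e\<close> would generate \<open>a\<close>, as \<open>a\<close> has prime
        order.\<close>
      have "e = inv w \<otimes> h" using we(1,3) eG by (simp add: l_inv_cancel)
      then have eM: "e \<in> W <#> H" using W.m_inv_closed[OF we(1)] h unfolding set_mult_def by blast
      have "e = \<one>"
      proof (rule ccontr)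
        assume "e \<noteq> \<one>"
        then have "a \<in> generate G {e}" by (rule prime_ord_generate[OF aG pa we(2)])
        moreover have "generate G {e} \<subseteq> W <#> H"
          by (rule generate_subgroup_incl[OF _ MG]) (use eM in simp)
        ultimately show False using aM by blast
      qed
      then have "h = w" using we(1,3) by simp
      then show "h \<in> {\<one>}" using WH h we(1) by blast
    qed
    have "W \<subseteq> W'" unfolding W'_def
      by (rule subset_set_mult_left[OF W.subset subgroup.one_closed[OF agG]])
    then have "W' = W" using max W'N W'A W'H unfolding \<W>_def by blast
    moreover have "a \<in> W'"
      using subset_set_mult_right[OF subgroup.subset[OF agG] W.one_closed] generate.incl[of a "{a}" G]
      unfolding W'_def by blast
    ultimately show False using W_M aM by blast
  qed
  then have AM: "A \<subseteq> W <#> H"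
    using generate_subgroup_incl[OF _ MG] Agen by blast
  have AHG: "subgroup (A <#> H) G" by (rule mult_norm_subgroup[OF AN HG])
  \<comment> \<open>Complementing \<open>R\<close> in \<open>B\<close> supplies what
    \<open>A <#> H\<close> misses: \<open>G\<close> is \<open>A <#> H\<close> times
    \<open>F\<close>, and \<open>F\<close> meets \<open>A <#> H\<close> trivially.\<close>
  define R where "R = B \<inter> (A <#> H)"
  have RG: "subgroup R G" unfolding R_def by (rule subgroups_Inter_pair[OF BG AHG])
  have "subgroup R (G\<lparr>carrier := B\<rparr>)" by (rule subgroup_incl[OF RG BG]) (simp add: R_def)
  then obtain F where F: "perm_complement (G\<lparr>carrier := B\<rparr>) R F"
    using BC unfolding C_group_def by blast
  have FB: "subgroup F (G\<lparr>carrier := B\<rparr>)" "R <#> F = B" "R \<inter> F = {\<one>}"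
    using F unfolding perm_complement_def by auto
  have FG: "subgroup F G" by (rule incl_subgroup[OF BG FB(1)])
  have FsubB: "F \<subseteq> B" using subgroup.subset[OF FB(1)] by simp
  have "perm_complement G H (W <#> F)"
  proof (rule perm_complementI[OF HG mult_norm_subgroup[OF WN FG]])
    fix g assume g: "g \<in> carrier G"
    obtain a b where ab: "a \<in> A" "b \<in> B" "g = a \<otimes> b"
      using perm_complement_decomp[OF B A.subgroup_axioms subgroup_self A.subset g] .
    then obtain r f where rf: "r \<in> R" "f \<in> F" "b = r \<otimes> f" using FB(2) unfolding set_mult_def by blast
    then obtain a1 h1 where ah: "a1 \<in> A" "h1 \<in> H" "r = a1 \<otimes> h1"
      unfolding R_def set_mult_def by blast
    have fG: "f \<in> carrier G" by (rule subgroup.mem_carrier[OF FG rf(2)])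
    \<comment> \<open>The part from \<open>A\<close> is moved to the right of \<open>h1\<close> by
      conjugation. Decomposing its inverse in \<open>W <#> H\<close> yields, after inverting, the
      factor from \<open>H\<close> on the left of the one from \<open>W\<close>.\<close>
    have "inv (inv h1 \<otimes> (a \<otimes> a1) \<otimes> h1) \<in> W <#> H"
      by (rule set_mp[OF AM], rule A.m_inv_closed, rule A.inv_op_closed1)
        (use ab(1) ah(1,2) in simp_all)
    then obtain w h2 where wh: "w \<in> W" "h2 \<in> H" "inv (inv h1 \<otimes> (a \<otimes> a1) \<otimes> h1) = w \<otimes> h2"
      unfolding set_mult_def by blast
    have c: "a \<in> carrier G" "a1 \<in> carrier G" "h1 \<in> carrier G" "w \<in> carrier G" "h2 \<in> carrier G"
      using ab(1) ah(1,2) wh by simp_all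
    have "inv h1 \<otimes> (a \<otimes> a1) \<otimes> h1 = inv (w \<otimes> h2)"
      unfolding wh(3)[symmetric] using c by simp
    then have "h1 \<otimes> (inv h1 \<otimes> (a \<otimes> a1) \<otimes> h1) = h1 \<otimes> (inv h2 \<otimes> inv w)"
      using c by (simp add: inv_mult_group)
    then have "a \<otimes> a1 \<otimes> h1 = (h1 \<otimes> inv h2) \<otimes> inv w" using c by (simp add: group_normalize)
    moreover have "g = (a \<otimes> a1 \<otimes> h1) \<otimes> f"
      unfolding ab(3) rf(3) ah(3) using c fG by (simp add: m_assoc)
    ultimately have "g = (h1 \<otimes> inv h2) \<otimes> (inv w \<otimes> f)" using c fG by (simp add: m_assoc)
    moreover have "h1 \<otimes> inv h2 \<in> H" using ah wh by simp
    moreover have "inv w \<otimes> f \<in> W <#> F" using W.m_inv_closed[OF wh(1)] rf(2)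
      unfolding set_mult_def by blast
    ultimately show "\<exists>h\<in>H. \<exists>k\<in>W <#> F. g = h \<otimes> k" by blast
  next
    fix h assume h: "h \<in> H" "h \<in> W <#> F"
    then obtain w f where wf: "w \<in> W" "f \<in> F" "h = w \<otimes> f" unfolding set_mult_def by blast
    have fG: "f \<in> carrier G" by (rule subgroup.mem_carrier[OF FG wf(2)])
    have "f = inv w \<otimes> h" using wf fG by (simp add: l_inv_cancel)
    then have "f \<in> A <#> H" using W.m_inv_closed[OF wf(1)] WA h unfolding set_mult_def by blast
    then have "f = \<one>" using FB(3) FsubB wf(2) unfolding R_def by blast
    then have "h = w" using wf by simp
    then show "h = \<one>" using WH h wf by blast
  qed
  then show "\<exists>K. perm_complement G H K" by blast
qed

section \<open>Torsion\<close>

text \<open>For a complement of the subgroup generated by the square of \<open>x\<close>, the factor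
  \<open>k\<close> of \<open>x\<close> is an odd power of \<open>x\<close>, while the square of
  \<open>k\<close> lies in both subgroups and is trivial. If \<open>x\<close> had infinite order,
  encoded as \<open>ord x = 0\<close>, an odd exponent would have to be 0.\<close>

lemma C_group_imp_ord_neq_0:
  assumes C: "C_group G" and x: "x \<in> carrier G"
  shows "ord x \<noteq> 0"
proof
  assume o: "ord x = 0"
  have x2: "x [^] (2::int) \<in> carrier G" using x by simp
  have HG: "subgroup (generate G {x [^] (2::int)}) G"
    by (rule generate_is_subgroup) (use x2 in simp)
  then obtain K where K: "perm_complement G (generate G {x [^] (2::int)}) K"
    using C unfolding C_group_def by blast
  have KG: "subgroup K G" by (rule perm_complement_subgroup[OF K])
  obtain h k where hk: "h \<in> generate G {x [^] (2::int)}" "k \<in> K" "x = h \<otimes> k"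
    using perm_complement_decomp[OF K HG subgroup_self subgroup.subset[OF HG] x] .
  have kG: "k \<in> carrier G" by (rule subgroup.mem_carrier[OF KG hk(2)])
  obtain i :: int where "h = (x [^] (2::int)) [^] i" using hk(1) generate_pow[OF x2] by blast
  then have h: "h = x [^] (2 * i)" using int_pow_pow[OF x] by (simp add: mult.commute)
  have "k = inv h \<otimes> x" unfolding hk(3) using h x kG by (simp add: l_inv_cancel)
  also have "\<dots> = x [^] (- (2 * i)) \<otimes> x [^] (1::int)"
    unfolding h using x by (simp only: int_pow_neg int_pow_1)
  also have "\<dots> = x [^] (- (2 * i) + 1)" by (rule int_pow_mult[OF x, symmetric])
  finally have k: "k = x [^] (1 - 2 * i)" by simp
  have k2: "k [^] (2::int) = x [^] (2 * (1 - 2 * i))"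
    unfolding k using int_pow_pow[OF x, of "1 - 2 * i" 2] by (simp add: mult.commute)
  have "k [^] (2::int) = (x [^] (2::int)) [^] (1 - 2 * i)"
    unfolding k2 using int_pow_pow[OF x, of 2 "1 - 2 * i"] by (simp add: mult.commute)
  then have "k [^] (2::int) \<in> generate G {x [^] (2::int)}" using generate_pow[OF x2] by blast
  moreover have "k [^] (2::int) \<in> K" by (rule subgroup_int_pow_closed[OF KG hk(2)])
  ultimately have "k [^] (2::int) = \<one>" by (rule perm_complement_Int[OF K])
  then have "int (ord x) dvd 2 * (1 - 2 * i)" unfolding k2 using int_pow_eq_id[OF x] by blast
  then have "1 = 2 * i" using o by simp
  then show False by presburger
qed

lemma torsion_group_iff: "torsion_group G \<longleftrightarrow> (\<forall>x\<in>carrier G. ord x \<noteq> 0)"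
  unfolding torsion_group_def using ord_eq_0 by (metis neq0_conv)

lemma finite_generate_singleton:
  assumes "x \<in> carrier G" "ord x \<noteq> 0"
  shows "finite (generate G {x})"
  using generate_pow_card[OF assms(1)] assms(2) card.infinite by fastforce

text \<open>Generators are adjoined one at a time: the cyclic group of \<open>s\<close> commutes
  with the group generated so far, so their product is a finite subgroup.\<close>

lemma finite_generate_abelian_torsion:
  assumes fin: "finite S" and S: "S \<subseteq> carrier G"
    and comm: "\<And>x y. \<lbrakk>x \<in> S; y \<in> S\<rbrakk> \<Longrightarrow> x \<otimes> y = y \<otimes> x"
    and tors: "\<And>x. x \<in> S \<Longrightarrow> ord x \<noteq> 0"
  shows "finite (generate G S)"
  using assms
proof (induction S rule: finite_induct)
  case empty
  then show ?case by (simp add: generate_empty)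
next
  case (insert s S)
  define P where "P = generate G {s}"
  define Q where "Q = generate G S"
  have s: "s \<in> carrier G" and S: "S \<subseteq> carrier G" using insert.prems(1) by auto
  have PG: "subgroup P G" unfolding P_def by (rule generate_is_subgroup) (use s in simp)
  have QG: "subgroup Q G" unfolding Q_def by (rule generate_is_subgroup[OF S])
  interpret P: subgroup P G by (rule PG)
  interpret Q: subgroup Q G by (rule QG)
  have finP: "finite P" unfolding P_def using insert.prems(3) s finite_generate_singleton by blast
  have finQ: "finite Q" unfolding Q_def using insert.IH[OF S] insert.prems by blast
  have PQ: "p \<otimes> q = q \<otimes> p" if "p \<in> P" "q \<in> Q" for p q
    by (rule generate_centralizes[OF S _ _ that[unfolded P_def Q_def]])
      (use s insert.prems(2) in auto)
  have "subgroup (P <#> Q) G"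
  proof (rule subgroupI)
    show "P <#> Q \<subseteq> carrier G" by (rule setmult_subset_G[OF P.subset Q.subset])
    show "P <#> Q \<noteq> {}" using P.one_closed Q.one_closed unfolding set_mult_def by blast
    fix a assume "a \<in> P <#> Q"
    then obtain p q where pq: "p \<in> P" "q \<in> Q" "a = p \<otimes> q" unfolding set_mult_def by blast
    have "inv a = inv p \<otimes> inv q"
      unfolding pq(3) PQ[OF pq(1,2)] using pq(1,2) by (simp add: inv_mult_group)
    then show "inv a \<in> P <#> Q"
      using P.m_inv_closed[OF pq(1)] Q.m_inv_closed[OF pq(2)] unfolding set_mult_def by blast
    fix b assume "b \<in> P <#> Q"
    then obtain p' q' where pq': "p' \<in> P" "q' \<in> Q" "b = p' \<otimes> q'" unfolding set_mult_def by blast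
    have "a \<otimes> b = p \<otimes> (q \<otimes> p') \<otimes> q'"
      unfolding pq(3) pq'(3) using pq(1,2) pq'(1,2) by (simp add: m_assoc)
    also have "q \<otimes> p' = p' \<otimes> q" using PQ[OF pq'(1) pq(2)] by (rule sym)
    finally have "a \<otimes> b = (p \<otimes> p') \<otimes> (q \<otimes> q')" using pq(1,2) pq'(1,2) by (simp add: m_assoc)
    then show "a \<otimes> b \<in> P <#> Q"
      using P.m_closed[OF pq(1) pq'(1)] Q.m_closed[OF pq(2) pq'(2)] unfolding set_mult_def by blast
  qed
  moreover have "insert s S \<subseteq> P <#> Q"
  proof -
    have "s \<in> P" unfolding P_def by (simp add: generate.incl)
    moreover have "S \<subseteq> Q" unfolding Q_def by (auto intro: generate.incl)
    ultimately show ?thesis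
      using subset_set_mult_left[OF P.subset Q.one_closed]
        subset_set_mult_right[OF Q.subset P.one_closed] by blast
  qed
  ultimately have "generate G (insert s S) \<subseteq> P <#> Q" by (intro generate_subgroup_incl)
  moreover have "finite (P <#> Q)" unfolding set_mult_def using finP finQ by simp
  ultimately show ?case by (rule finite_subset)
qed

subsection \<open>Conjugacy classes\<close>

definition conj_class :: "'a \<Rightarrow> 'a set" where
  "conj_class x = (\<lambda>g. g \<otimes> x \<otimes> inv g) ` carrier G"

lemma conj_class_subset: "x \<in> carrier G \<Longrightarrow> conj_class x \<subseteq> carrier G"
  by (auto simp: conj_class_def)

lemma self_in_conj_class: "x \<in> carrier G \<Longrightarrow> x \<in> conj_class x"
  unfolding conj_class_def by (rule image_eqI[of _ _ \<one>]) auto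

lemma conj_conj:
  assumes "g \<in> carrier G" "h \<in> carrier G" "x \<in> carrier G"
  shows "g \<otimes> (h \<otimes> x \<otimes> inv h) \<otimes> inv g = (g \<otimes> h) \<otimes> x \<otimes> inv (g \<otimes> h)"
  using assms by (simp add: group_normalize)

lemma conj_mem_conj_class:
  assumes "x \<in> carrier G" "c \<in> conj_class x" "g \<in> carrier G"
  shows "g \<otimes> c \<otimes> inv g \<in> conj_class x"
  using assms unfolding conj_class_def by (auto simp: conj_conj)

lemma conj_class_subset_normal:
  assumes "A \<lhd> G" "x \<in> A"
  shows "conj_class x \<subseteq> A"
  using normal.inv_op_closed2[OF assms(1) _ assms(2)] by (auto simp: conj_class_def)

text \<open>The elementary form of the orbit-stabilizer theorem, the bridge between conjugates and
  cosets of centralizers.\<close>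

lemma conj_eq_iff:
  assumes "g \<in> carrier G" "h \<in> carrier G" "x \<in> carrier G"
  shows "g \<otimes> x \<otimes> inv g = h \<otimes> x \<otimes> inv h \<longleftrightarrow> (inv h \<otimes> g) \<otimes> x = x \<otimes> (inv h \<otimes> g)"
proof
  assume eq: "g \<otimes> x \<otimes> inv g = h \<otimes> x \<otimes> inv h"
  have "(inv h \<otimes> g) \<otimes> x = inv h \<otimes> (g \<otimes> x \<otimes> inv g) \<otimes> g"
    using assms by (simp add: group_normalize)
  also have "\<dots> = x \<otimes> (inv h \<otimes> g)" unfolding eq using assms by (simp add: group_normalize)
  finally show "(inv h \<otimes> g) \<otimes> x = x \<otimes> (inv h \<otimes> g)" .
next
  assume eq: "(inv h \<otimes> g) \<otimes> x = x \<otimes> (inv h \<otimes> g)"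
  have "g \<otimes> x \<otimes> inv g = h \<otimes> ((inv h \<otimes> g) \<otimes> x) \<otimes> inv g"
    using assms by (simp add: group_normalize)
  also have "\<dots> = h \<otimes> x \<otimes> inv h" unfolding eq using assms by (simp add: group_normalize)
  finally show "g \<otimes> x \<otimes> inv g = h \<otimes> x \<otimes> inv h" .
qed

text \<open>\<open>M\<close> lies in the centralizer of \<open>x\<close>, so the conjugate by
  \<open>g\<close> depends only on the coset of \<open>inv g\<close>. The inverse appears because
  \<open>rcosets\<close> are right cosets while conjugation has \<open>g\<close> on the
  left.\<close>

lemma finite_conj_class_if_finite_index:
  assumes M: "M \<subseteq> carrier G" and fin: "finite (rcosets M)" and x: "x \<in> carrier G"
    and one: "\<one> \<in> M" and cent: "\<And>m. m \<in> M \<Longrightarrow> m \<otimes> x = x \<otimes> m"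
  shows "finite (conj_class x)"
proof -
  define r where "r R = (SOME g. g \<in> carrier G \<and> M #> g = R)" for R
  have "conj_class x \<subseteq> (\<lambda>R. inv (r R) \<otimes> x \<otimes> inv (inv (r R))) ` (rcosets M)"
  proof
    fix c assume "c \<in> conj_class x"
    then obtain g where g: "g \<in> carrier G" "c = g \<otimes> x \<otimes> inv g" unfolding conj_class_def by blast
    define R where "R = M #> inv g"
    have R: "R \<in> rcosets M" unfolding R_def by (rule rcosetsI[OF M]) (use g in simp)
    have "\<exists>h. h \<in> carrier G \<and> M #> h = R" using g unfolding R_def by blast
    then have r: "r R \<in> carrier G" "M #> r R = R"
      unfolding r_def by (metis (mono_tags, lifting) someI_ex)+
    have "inv g \<in> M #> inv g"
      unfolding r_coset_def using one g by (intro UN_I[of \<one>]) simp_all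
    then have "inv g \<in> M #> r R" using r(2) R_def by simp
    then obtain m where m: "m \<in> M" "inv g = m \<otimes> r R" unfolding r_coset_def by blast
    have mG: "m \<in> carrier G" using m(1) M by blast
    have "inv (inv (r R)) \<otimes> g = inv m"
    proof -
      have "g = inv (m \<otimes> r R)" unfolding m(2)[symmetric] using g by simp
      then show ?thesis using r(1) mG by (simp add: group_normalize)
    qed
    moreover have "inv m \<otimes> x = x \<otimes> inv m"
      using commute_inv_right[OF x mG cent[OF m(1), symmetric]] by (rule sym)
    ultimately have "c = inv (r R) \<otimes> x \<otimes> inv (inv (r R))"
      unfolding g(2) using conj_eq_iff[of g "inv (r R)" x] g(1) r(1) x by simp
    then show "c \<in> (\<lambda>R. inv (r R) \<otimes> x \<otimes> inv (inv (r R))) ` (rcosets M)" using R by blast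
  qed
  then show ?thesis using fin finite_surj by blast
qed

text \<open>\<open>M\<close> contains the centralizer of \<open>x\<close>, so the coset of
  \<open>g\<close> is determined by the conjugate of \<open>x\<close> under
  \<open>inv g\<close>.\<close>

lemma finite_index_if_finite_conj_class:
  assumes M: "subgroup M G" and fin: "finite (conj_class x)" and x: "x \<in> carrier G"
    and cent: "\<And>g. \<lbrakk>g \<in> carrier G; g \<otimes> x = x \<otimes> g\<rbrakk> \<Longrightarrow> g \<in> M"
  shows "finite (rcosets M)"
proof -
  define r where "r c = (SOME g. g \<in> carrier G \<and> g \<otimes> x \<otimes> inv g = c)" for c
  have "rcosets M \<subseteq> (\<lambda>c. M #> inv (r c)) ` conj_class x"
  proof
    fix R assume "R \<in> rcosets M"
    then obtain g where g: "g \<in> carrier G" "R = M #> g" unfolding RCOSETS_def by blast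
    define c where "c = inv g \<otimes> x \<otimes> inv (inv g)"
    have c: "c \<in> conj_class x" unfolding conj_class_def c_def using g by blast
    have "\<exists>h. h \<in> carrier G \<and> h \<otimes> x \<otimes> inv h = c" using g unfolding c_def by blast
    then have r: "r c \<in> carrier G" "r c \<otimes> x \<otimes> inv (r c) = c"
      unfolding r_def by (metis (mono_tags, lifting) someI_ex)+
    have "inv (inv g) \<otimes> r c \<in> M"
    proof (rule cent)
      show "(inv (inv g) \<otimes> r c) \<otimes> x = x \<otimes> (inv (inv g) \<otimes> r c)"
        using conj_eq_iff[of "r c" "inv g" x] r g(1) x unfolding c_def by simp
    qed (use g r in simp)
    then have "g \<otimes> inv (inv (r c)) \<in> M" using g r by simp
    then have "g \<in> M #> inv (r c)"
      using subgroup.rcos_module_rev[OF M is_group, of "inv (r c)" g] r g by simp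
    then have "R = M #> inv (r c)" using repr_independence[OF _ _ M] g(2) r by simp
    then show "R \<in> (\<lambda>c. M #> inv (r c)) ` conj_class x" using c by blast
  qed
  then show ?thesis using fin finite_surj by blast
qed

text \<open>The conjugates of \<open>x\<close> generate a finite normal subgroup \<open>X'\<close>
  of \<open>A\<close>, so complements of finite subgroups suffice. In a profinite C-group these
  exist because finite subgroups are closed.\<close>

lemma generated_by_eigenelements_if_finite_conj_class:
  assumes AN: "A \<lhd> G" and comm: "\<And>x y. \<lbrakk>x \<in> A; y \<in> A\<rbrakk> \<Longrightarrow> x \<otimes> y = y \<otimes> x"
    and tors: "\<And>x. x \<in> A \<Longrightarrow> ord x \<noteq> 0"
    and fin: "\<And>x. x \<in> A \<Longrightarrow> finite (conj_class x)"
    and compl: "\<And>H. \<lbrakk>subgroup H G; finite H; H \<subseteq> A\<rbrakk> \<Longrightarrow> \<exists>K. perm_complement G H K"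
  shows "A \<subseteq> generate G (A \<inter> eigenelements)"
proof
  fix x assume x: "x \<in> A"
  interpret A: normal A G by (rule AN)
  have xG: "x \<in> carrier G" using x by simp
  define X' where "X' = generate G (conj_class x)"
  have cA: "conj_class x \<subseteq> A" by (rule conj_class_subset_normal[OF AN x])
  have cG: "conj_class x \<subseteq> carrier G" by (rule conj_class_subset[OF xG])
  have XN: "X' \<lhd> G" unfolding X'_def
    by (rule normal_generateI[OF cG]) (rule conj_mem_conj_class[OF xG])
  have XA: "X' \<subseteq> A" unfolding X'_def by (rule generate_subgroup_incl[OF cA A.subgroup_axioms])
  have finX: "finite X'" unfolding X'_def
    by (rule finite_generate_abelian_torsion[OF fin[OF x] cG]) (use cA comm tors in blast)+
  have "X' \<subseteq> generate G (X' \<inter> eigenelements)"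
  proof (rule abelian_normal_generated_by_eigenelements[OF XN])
    show "\<exists>K. perm_complement G H K" if "subgroup H G" "H \<subseteq> X'" for H
      using compl[OF that(1) finite_subset[OF that(2) finX]] that(2) XA by blast
  qed (use XA comm tors in blast)+
  also have "\<dots> \<subseteq> generate G (A \<inter> eigenelements)"
    by (rule mono_generate) (use XA in blast)
  finally show "x \<in> generate G (A \<inter> eigenelements)"
    using self_in_conj_class[OF xG] unfolding X'_def by (auto intro: generate.incl)
qed

section \<open>Elements with finitely many conjugates\<close>

lemma finite_conj_class_mult:
  assumes "x \<in> carrier G" "y \<in> carrier G" "finite (conj_class x)" "finite (conj_class y)"
  shows "finite (conj_class (x \<otimes> y))" "card (conj_class (x \<otimes> y)) \<le> card (conj_class x) * card (conj_class y)"
proof -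
  have sub: "conj_class (x \<otimes> y) \<subseteq> (\<lambda>(a, b). a \<otimes> b) ` (conj_class x \<times> conj_class y)"
  proof
    fix c assume "c \<in> conj_class (x \<otimes> y)"
    then obtain g where g: "g \<in> carrier G" "c = g \<otimes> (x \<otimes> y) \<otimes> inv g"
      unfolding conj_class_def by blast
    then have "c = (g \<otimes> x \<otimes> inv g) \<otimes> (g \<otimes> y \<otimes> inv g)" using assms conj_mult by simp
    then show "c \<in> (\<lambda>(a, b). a \<otimes> b) ` (conj_class x \<times> conj_class y)"
      using g unfolding conj_class_def by blast
  qed
  have fin: "finite (conj_class x \<times> conj_class y)" using assms by simp
  show "finite (conj_class (x \<otimes> y))" by (rule finite_subset[OF sub finite_imageI[OF fin]])
  have "card (conj_class (x \<otimes> y)) \<le> card ((\<lambda>(a, b). a \<otimes> b) ` (conj_class x \<times> conj_class y))"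
    by (rule card_mono[OF finite_imageI[OF fin] sub])
  also have "\<dots> \<le> card (conj_class x \<times> conj_class y)" by (rule card_image_le[OF fin])
  finally show "card (conj_class (x \<otimes> y)) \<le> card (conj_class x) * card (conj_class y)"
    by (simp add: card_cartesian_product)
qed

lemma finite_conj_class_inv:
  assumes "x \<in> carrier G" "finite (conj_class x)"
  shows "finite (conj_class (inv x))"
proof -
  have "conj_class (inv x) \<subseteq> m_inv G ` conj_class x"
    unfolding conj_class_def using conj_inv[OF _ assms(1)] by auto
  then show ?thesis using assms(2) finite_surj by blast
qed

text \<open>An eigenelement has its conjugates inside a finite cyclic group, and elements with
  finite classes are closed under products and inverses.\<close>

lemma finite_conj_class_generated_by_eigenelements:
  assumes "x \<in> generate G (A \<inter> eigenelements)"
  shows "finite (conj_class x)"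
  using assms
proof (induction rule: generate.induct)
  case one
  have "conj_class \<one> \<subseteq> {\<one>}" by (auto simp: conj_class_def)
  then show ?case by (rule finite_subset) simp
next
  case (incl h)
  then have h: "h \<in> carrier G" "Factorial_Ring.prime (ord h)"
    "\<forall>g\<in>carrier G. g \<otimes> h \<otimes> inv g \<in> generate G {h}" by (auto simp: eigenelements_def)
  then have "conj_class h \<subseteq> generate G {h}" by (auto simp: conj_class_def)
  moreover have "finite (generate G {h})"
    by (rule finite_generate_singleton[OF h(1)]) (use h(2) in auto)
  ultimately show ?case by (rule finite_subset)
next
  case (inv h)
  then have h: "h \<in> carrier G" "Factorial_Ring.prime (ord h)"
    "\<forall>g\<in>carrier G. g \<otimes> h \<otimes> inv g \<in> generate G {h}" by (auto simp: eigenelements_def)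
  then have "conj_class h \<subseteq> generate G {h}" by (auto simp: conj_class_def)
  moreover have "finite (generate G {h})"
    by (rule finite_generate_singleton[OF h(1)]) (use h(2) in auto)
  ultimately have "finite (conj_class h)" by (rule finite_subset)
  then show ?case by (rule finite_conj_class_inv[OF h(1)])
next
  case (eng h1 h2)
  have "generate G (A \<inter> eigenelements) \<subseteq> carrier G"
    by (rule generate_incl) (use eigenelements_subset in blast)
  then show ?case using finite_conj_class_mult(1)[of h1 h2] eng by blast
qed

text \<open>Let \<open>x\<close> have a class of maximal size. If \<open>u\<close> centralizes
  \<open>x\<close> but not \<open>A\<close>, it fails to commute with some eigenelement
  \<open>e\<close> of \<open>A\<close>. Then the class of \<open>x \<otimes> e\<close> maps onto
  that of \<open>x\<close>, but not injectively, which contradicts maximality.\<close>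

lemma centralizer_of_maximal_conj_class:
  assumes AN: "A \<lhd> G" and comm: "\<And>x y. \<lbrakk>x \<in> A; y \<in> A\<rbrakk> \<Longrightarrow> x \<otimes> y = y \<otimes> x"
    and Agen: "A \<subseteq> generate G (A \<inter> eigenelements)"
    and bound: "\<And>a. a \<in> A \<Longrightarrow> card (conj_class a) \<le> n"
  obtains x where "x \<in> A"
    "\<And>u a. \<lbrakk>u \<in> carrier G; u \<otimes> x = x \<otimes> u; a \<in> A\<rbrakk> \<Longrightarrow> u \<otimes> a = a \<otimes> u"
proof -
  interpret A: normal A G by (rule AN)
  obtain x where x: "x \<in> A" and max: "\<forall>a. a \<in> A \<longrightarrow> card (conj_class a) \<le> card (conj_class x)"
    using ex_has_greatest_nat[of "\<lambda>a. a \<in> A" \<one> "\<lambda>a. card (conj_class a)" "Suc n"] A.one_closed bound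
    by (auto simp: less_Suc_eq_le)
  have xG: "x \<in> carrier G" using x by simp
  have "u \<otimes> a = a \<otimes> u" if u: "u \<in> carrier G" "u \<otimes> x = x \<otimes> u" and a: "a \<in> A" for u a
  proof (rule ccontr)
    assume ne: "u \<otimes> a \<noteq> a \<otimes> u"
    have "\<exists>e\<in>A \<inter> eigenelements. u \<otimes> e \<noteq> e \<otimes> u"
    proof (rule ccontr)
      assume "\<not> (\<exists>e\<in>A \<inter> eigenelements. u \<otimes> e \<noteq> e \<otimes> u)"
      then have all: "u \<otimes> e = e \<otimes> u" if "e \<in> A \<inter> eigenelements" for e using that by blast
      have "u \<otimes> a = a \<otimes> u"
      proof (rule generate_centralizes[of "A \<inter> eigenelements" "{u}"])
        show "u \<in> generate G {u}" by (simp add: generate.incl)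
        show "a \<in> generate G (A \<inter> eigenelements)" using Agen a by blast
      qed (use all u(1) eigenelements_subset in auto)
      then show False using ne by simp
    qed
    then obtain e where e: "e \<in> A" "e \<in> eigenelements" and ue: "u \<otimes> e \<noteq> e \<otimes> u" by blast
    have eG: "e \<in> carrier G" using e by simp
    have eprime: "Factorial_Ring.prime (ord e)" and econj: "\<And>g. g \<in> carrier G \<Longrightarrow> g \<otimes> e \<otimes> inv g \<in> generate G {e}"
      using e(2) by (auto simp: eigenelements_def)
    define X' where "X' = generate G (conj_class x)"
    have cG: "conj_class x \<subseteq> carrier G" by (rule conj_class_subset[OF xG])
    have XG: "subgroup X' G" unfolding X'_def by (rule generate_is_subgroup[OF cG])
    \<comment> \<open>Conjugating \<open>u\<close> changes it only by a commutator \<open>w\<close>,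
      and \<open>w\<close> centralizes \<open>x\<close>; hence \<open>u\<close> centralizes every
      conjugate of \<open>x\<close>.\<close>
    have u_class: "u \<otimes> c = c \<otimes> u" if c: "c \<in> conj_class x" for c
    proof -
      obtain h where h: "c = h \<otimes> x \<otimes> inv h" "h \<in> carrier G"
        using c unfolding conj_class_def by (rule imageE)
      define w where "w = inv h \<otimes> u \<otimes> inv (inv h) \<otimes> inv u"
      have "w \<in> derived_set G (carrier G)" unfolding w_def using h(2) u(1) by blast
      then have w: "w \<in> derived G (carrier G)" unfolding derived_def by (rule generate.incl)
      have wG: "w \<in> carrier G" unfolding w_def using h(2) u(1) by simp
      have wx: "w \<otimes> x = x \<otimes> w"
        using derived_centralizes_generated_by_eigenelements[OF set_mp[OF Agen x] w] .
      have "inv h \<otimes> (u \<otimes> h) = w \<otimes> u" unfolding w_def using h(2) u(1) by (simp add: group_normalize)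
      moreover have "w \<otimes> u \<otimes> x = x \<otimes> (w \<otimes> u)"
      proof -
        have "w \<otimes> u \<otimes> x = w \<otimes> (x \<otimes> u)" using wG u xG by (simp add: m_assoc)
        also have "\<dots> = (w \<otimes> x) \<otimes> u" using wG u xG by (simp add: m_assoc)
        also have "\<dots> = x \<otimes> (w \<otimes> u)" unfolding wx using wG u xG by (simp add: m_assoc)
        finally show ?thesis .
      qed
      ultimately have "(u \<otimes> h) \<otimes> x \<otimes> inv (u \<otimes> h) = c"
        unfolding h(1) using conj_eq_iff[of "u \<otimes> h" h x] h(2) u(1) xG by simp
      then have "u \<otimes> c \<otimes> inv u = c" unfolding h(1) using conj_conj[OF u(1) h(2) xG] by simp
      moreover have "c \<in> carrier G" using c cG by blast
      ultimately show ?thesis using conj_fixed_iff_commute[OF u(1)] by simp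
    qed
    have uX: "u \<otimes> c = c \<otimes> u" if "c \<in> X'" for c
      by (rule generate_centralizes[OF cG _ _ _ that[unfolded X'_def], of "{u}"])
        (use u(1) u_class in \<open>auto intro: generate.incl\<close>)
    \<comment> \<open>\<open>X'\<close> and the cyclic group of \<open>e\<close> meet trivially:
      otherwise \<open>e\<close> would lie in \<open>X'\<close> and commute with \<open>u\<close>.
      So an element centralizing the product \<open>x \<otimes> e\<close> must centralize both
      factors.\<close>
    have split: "v \<otimes> x = x \<otimes> v \<and> v \<otimes> e = e \<otimes> v"
      if v: "v \<in> carrier G" "v \<otimes> (x \<otimes> e) = (x \<otimes> e) \<otimes> v" for v
    proof -
      define x' where "x' = v \<otimes> x \<otimes> inv v"
      define e' where "e' = v \<otimes> e \<otimes> inv v"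
      have cc: "x' \<in> carrier G" "e' \<in> carrier G" unfolding x'_def e'_def using v(1) xG eG by simp_all
      have "v \<otimes> (x \<otimes> e) \<otimes> inv v = x \<otimes> e"
        using conj_fixed_iff_commute[OF v(1), of "x \<otimes> e"] v(2) xG eG by simp
      then have eq: "x' \<otimes> e' = x \<otimes> e" unfolding x'_def e'_def using conj_mult[OF v(1) xG eG] by simp
      \<comment> \<open>The discrepancy \<open>z\<close> is an element of \<open>X'\<close> by its
        definition and of \<open>generate G {e}\<close> by the equation for the products.\<close>
      define z where "z = inv x \<otimes> x'"
      have "z = inv x \<otimes> (x' \<otimes> e') \<otimes> inv e'" unfolding z_def using cc xG by (simp add: group_normalize)
      also have "\<dots> = e \<otimes> inv e'" unfolding eq using cc xG eG by (simp add: group_normalize)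
      finally have z: "z = e \<otimes> inv e'" .
      have "x \<in> X'" "x' \<in> X'" unfolding X'_def
        using self_in_conj_class[OF xG] v(1) unfolding x'_def conj_class_def
        by (auto intro: generate.incl)
      then have zX: "z \<in> X'" unfolding z_def
        using subgroup.m_closed[OF XG] subgroup.m_inv_closed[OF XG] by blast
      have egG: "subgroup (generate G {e}) G" by (rule generate_is_subgroup) (use eG in simp)
      have ze: "z \<in> generate G {e}" unfolding z
        by (rule subgroup.m_closed[OF egG _ subgroup.m_inv_closed[OF egG]])
          (use econj[OF v(1)] in \<open>auto simp: e'_def intro: generate.incl\<close>)
      have z1: "z = \<one>"
      proof (rule ccontr)
        assume "z \<noteq> \<one>"
        then have "e \<in> generate G {z}" by (rule prime_ord_generate[OF eG eprime ze])
        moreover have "generate G {z} \<subseteq> X'" by (rule generate_subgroup_incl[OF _ XG]) (use zX in simp)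
        ultimately have "u \<otimes> e = e \<otimes> u" using uX by blast
        then show False using ue by simp
      qed
      have "x' = x \<otimes> z" unfolding z_def using xG cc by (simp add: group_normalize)
      then have "x' = x" using z1 xG by simp
      moreover have "e = z \<otimes> e'" unfolding z using eG cc by (simp add: group_normalize)
      then have "e' = e" using z1 cc by simp
      ultimately show ?thesis unfolding x'_def e'_def
        using conj_fixed_iff_commute[OF v(1)] xG eG by simp
    qed
    have xeG: "x \<otimes> e \<in> carrier G" using xG eG by simp
    define r where "r c = (SOME g. g \<in> carrier G \<and> g \<otimes> x \<otimes> inv g = c)" for c
    have r: "r c \<in> carrier G" "r c \<otimes> x \<otimes> inv (r c) = c" if c: "c \<in> conj_class x" for c
    proof -
      have "\<exists>g. g \<in> carrier G \<and> g \<otimes> x \<otimes> inv g = c" using c unfolding conj_class_def by blast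
      then show "r c \<in> carrier G" "r c \<otimes> x \<otimes> inv (r c) = c"
        unfolding r_def by (metis (mono_tags, lifting) someI_ex)+
    qed
    \<comment> \<open>A section of the map from the class of \<open>x \<otimes> e\<close> to the
      class of \<open>x\<close>; that map is well defined by \<open>conj_eq\<close>.\<close>
    define \<psi> where "\<psi> c = r c \<otimes> (x \<otimes> e) \<otimes> inv (r c)" for c
    have conj_eq: "g \<otimes> x \<otimes> inv g = h \<otimes> x \<otimes> inv h \<and> (inv h \<otimes> g) \<otimes> e = e \<otimes> (inv h \<otimes> g)"
      if "g \<in> carrier G" "h \<in> carrier G" "g \<otimes> (x \<otimes> e) \<otimes> inv g = h \<otimes> (x \<otimes> e) \<otimes> inv h" for g h
      using split[of "inv h \<otimes> g"] conj_eq_iff[of g h "x \<otimes> e"] conj_eq_iff[of g h x] that xG xeG by simp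
    have inj: "inj_on \<psi> (conj_class x)"
    proof (rule inj_onI)
      fix c d assume c: "c \<in> conj_class x" and d: "d \<in> conj_class x" and "\<psi> c = \<psi> d"
      then show "c = d" using conj_eq[OF r(1)[OF c] r(1)[OF d]] r(2)[OF c] r(2)[OF d]
        unfolding \<psi>_def by simp
    qed
    \<comment> \<open>\<open>card\<close> is 0 on infinite sets, so the strict growth below rests on
      this finiteness.\<close>
    have fin: "finite (conj_class (x \<otimes> e))"
      using finite_conj_class_generated_by_eigenelements[of "x \<otimes> e" A] Agen x e(1) by blast
    \<comment> \<open>The chosen \<open>g0\<close> centralizes \<open>x\<close> but need not be
      \<open>\<one>\<close>. The conjugate \<open>y\<close> lies over \<open>x\<close> like
      \<open>\<psi> x\<close>, and differs from it because \<open>u\<close> does not commute with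
      \<open>e\<close>.\<close>
    define g0 where "g0 = r x"
    have g0: "g0 \<in> carrier G" "g0 \<otimes> x \<otimes> inv g0 = x"
      unfolding g0_def using r[OF self_in_conj_class[OF xG]] by auto
    define y where "y = (g0 \<otimes> u) \<otimes> (x \<otimes> e) \<otimes> inv (g0 \<otimes> u)"
    have y: "y \<in> conj_class (x \<otimes> e)" unfolding y_def conj_class_def using g0(1) u(1) by blast
    have ux: "(g0 \<otimes> u) \<otimes> x \<otimes> inv (g0 \<otimes> u) = x"
      using conj_conj[OF g0(1) u(1) xG] conj_fixed_iff_commute[OF u(1) xG] u(2) g0(2) by simp
    have "y \<notin> \<psi> ` conj_class x"
    proof
      assume "y \<in> \<psi> ` conj_class x"
      then obtain c where c: "c \<in> conj_class x" "y = \<psi> c" by blast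
      have eq: "(g0 \<otimes> u) \<otimes> (x \<otimes> e) \<otimes> inv (g0 \<otimes> u) = r c \<otimes> (x \<otimes> e) \<otimes> inv (r c)"
        using c(2) unfolding y_def \<psi>_def .
      have g0u: "g0 \<otimes> u \<in> carrier G" using g0(1) u(1) by simp
      note * = conj_eq[OF g0u r(1)[OF c(1)] eq]
      then have "c = x" using ux r(2)[OF c(1)] by simp
      then have "inv (r c) \<otimes> (g0 \<otimes> u) = u" using g0(1) u(1) unfolding g0_def by (simp add: l_inv_cancel)
      then show False using * ue by simp
    qed
    moreover have "\<psi> ` conj_class x \<subseteq> conj_class (x \<otimes> e)"
      unfolding \<psi>_def conj_class_def[of "x \<otimes> e"] using r(1) by blast
    ultimately have "\<psi> ` conj_class x \<subset> conj_class (x \<otimes> e)" using y by blast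
    then have "card (\<psi> ` conj_class x) < card (conj_class (x \<otimes> e))" by (rule psubset_card_mono[OF fin])
    then have "card (conj_class x) < card (conj_class (x \<otimes> e))" using card_image[OF inj] by simp
    moreover have "x \<otimes> e \<in> A" using x e(1) by simp
    ultimately show False using max by (simp add: leD)
  qed
  with x show ?thesis by (rule that)
qed

end

subsection \<open>Profinite groups\<close>

locale profinite = group G for G (structure) +
  fixes T :: "'a topology"
  assumes profinite: "profinite_group G T"
begin

lemma topspace_T [simp]: "topspace T = carrier G"
  and compact_T: "compact_space T"
  and Hausdorff_T: "Hausdorff_space T"
  and continuous_map_inv: "continuous_map T T (\<lambda>x. inv x)"
  and continuous_map_mult_prod: "continuous_map (prod_topology T T) T (\<lambda>(x, y). x \<otimes> y)"
  using profinite by (simp_all add: profinite_group_def topological_group_def)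

lemma continuous_map_mult:
  assumes "continuous_map Z T f" "continuous_map Z T g"
  shows "continuous_map Z T (\<lambda>z. f z \<otimes> g z)"
  using continuous_map_compose[OF continuous_map_pairedI[OF assms] continuous_map_mult_prod]
  by (simp add: o_def)

lemma continuous_map_const_group:
  "g \<in> carrier G \<Longrightarrow> continuous_map Z T (\<lambda>z. g)"
  by simp

lemma continuous_map_translation:
  assumes "g \<in> carrier G"
  shows "continuous_map T T (\<lambda>x. g \<otimes> x)" "continuous_map T T (\<lambda>x. x \<otimes> g)"
  using assms
  by (intro continuous_map_mult continuous_map_const_group continuous_map_id[unfolded id_def]; simp)+

lemma continuous_map_conj:
  "g \<in> carrier G \<Longrightarrow> continuous_map T T (\<lambda>x. g \<otimes> x \<otimes> inv g)"
  by (intro continuous_map_mult continuous_map_const_group continuous_map_id[unfolded id_def]) auto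

text \<open>In a compact Hausdorff space quasi-components are components, here single points, and
  points in different quasi-components are separated by clopen sets.\<close>

lemma ex_clopen_separating:
  assumes "x \<in> carrier G" "x \<noteq> \<one>"
  obtains U where "openin T U" "closedin T U" "\<one> \<in> U" "x \<notin> U"
proof -
  have "quasi_components_of T = connected_components_of T"
    by (rule quasi_eq_connected_components_of) (simp add: compact_T Hausdorff_T)
  then have "quasi_component_of T \<one> = connected_component_of T \<one>"
    using quasi_eq_connected_components_of_pointwise by force
  moreover have "connected_component_of_set T \<one> = {\<one>}"
    using profinite by (simp add: profinite_group_def totally_disconnected_space_def)
  ultimately have "\<not> quasi_component_of T \<one> x" using assms(2) by auto
  then show ?thesis using assms(1) that unfolding quasi_component_of by auto
qed

lemma ex_open_normal_subgroup_separating: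
  assumes x: "x \<in> carrier G" "x \<noteq> \<one>"
  obtains N where "N \<lhd> G" "openin T N" "x \<notin> N"
proof -
  obtain U where U: "openin T U" "closedin T U" "\<one> \<in> U" "x \<notin> U"
    using ex_clopen_separating[OF x] .
  \<comment> \<open>The normal core of the stabilizer of \<open>U\<close>; the tube lemma makes it open.\<close>
  define N where "N = {g \<in> carrier G. \<forall>u\<in>carrier G. \<forall>v\<in>carrier G. u \<otimes> g \<otimes> v \<in> U \<longleftrightarrow> u \<otimes> v \<in> U}"
  have N_D: "u \<otimes> g \<otimes> v \<in> U \<longleftrightarrow> u \<otimes> v \<in> U" if "g \<in> N" "u \<in> carrier G" "v \<in> carrier G" for g u v
    using that unfolding N_def by blast
  have NG: "g \<in> carrier G" if "g \<in> N" for g using that unfolding N_def by blast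
  have "N \<lhd> G" unfolding normal_inv_iff
  proof (intro conjI ballI)
    show "subgroup N G"
    proof (rule subgroupI)
      show "N \<subseteq> carrier G" using NG by blast
      have "\<one> \<in> N" unfolding N_def by simp
      then show "N \<noteq> {}" by blast
    next
      fix g assume g: "g \<in> N"
      have "u \<otimes> inv g \<otimes> v \<in> U \<longleftrightarrow> u \<otimes> v \<in> U" if uv: "u \<in> carrier G" "v \<in> carrier G" for u v
        using N_D[OF g, of "u \<otimes> inv g" v] uv NG[OF g] by (simp add: group_normalize)
      then show "inv g \<in> N" unfolding N_def using NG[OF g] by simp
    next
      fix g h assume g: "g \<in> N" and h: "h \<in> N"
      have "u \<otimes> (g \<otimes> h) \<otimes> v \<in> U \<longleftrightarrow> u \<otimes> v \<in> U" if uv: "u \<in> carrier G" "v \<in> carrier G" for u v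
        using N_D[OF g, of u "h \<otimes> v"] N_D[OF h, of u v] uv NG[OF g] NG[OF h] by (simp add: m_assoc)
      then show "g \<otimes> h \<in> N" unfolding N_def using NG[OF g] NG[OF h] by simp
    qed
  next
    fix k g assume k: "k \<in> carrier G" and g: "g \<in> N"
    have "u \<otimes> (k \<otimes> g \<otimes> inv k) \<otimes> v \<in> U \<longleftrightarrow> u \<otimes> v \<in> U" if uv: "u \<in> carrier G" "v \<in> carrier G" for u v
      using N_D[OF g, of "u \<otimes> k" "inv k \<otimes> v"] uv k NG[OF g] by (simp add: group_normalize)
    then show "k \<otimes> g \<otimes> inv k \<in> N" unfolding N_def using NG[OF g] k by simp
  qed
  moreover have "openin T N"
  proof -
    define Z where "Z = prod_topology T (prod_topology T T)"
    define f where "f = (\<lambda>z. fst (snd z) \<otimes> fst z \<otimes> snd (snd z))"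
    define h where "h = (\<lambda>z::'a \<times> 'a \<times> 'a. fst (snd z) \<otimes> snd (snd z))"
    have proj: "continuous_map Z T fst" "continuous_map Z T (\<lambda>z. fst (snd z))"
      "continuous_map Z T (\<lambda>z. snd (snd z))"
      unfolding Z_def
      using continuous_map_compose[OF continuous_map_snd continuous_map_fst, of T T T]
        continuous_map_compose[OF continuous_map_snd continuous_map_snd, of T T T]
      by (simp_all add: continuous_map_fst o_def)
    have f: "continuous_map Z T f" and h: "continuous_map Z T h"
      unfolding f_def h_def by (intro continuous_map_mult proj)+
    have V: "closedin T (carrier G - U)" using U(1) by (metis closedin_diff closedin_topspace topspace_T)
    \<comment> \<open>The triples for which inserting \<open>g\<close> between \<open>u\<close> and
      \<open>v\<close> changes membership in \<open>U\<close>. They form a closed set because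
      \<open>U\<close> is clopen, and \<open>N\<close> is the complement of its projection, which is
      closed by compactness.\<close>
    define W where "W = ({z \<in> topspace Z. f z \<in> U} \<inter> {z \<in> topspace Z. h z \<in> carrier G - U}) \<union>
      ({z \<in> topspace Z. f z \<in> carrier G - U} \<inter> {z \<in> topspace Z. h z \<in> U})"
    have "closedin Z W" unfolding W_def
      by (intro closedin_Un closedin_Int closedin_continuous_map_preimage[OF f]
          closedin_continuous_map_preimage[OF h] U(2) V)
    moreover have "closed_map Z T fst" unfolding Z_def
      by (intro Abstract_Topological_Spaces.closed_map_fst)
        (simp add: compact_space_prod_topology compact_T)
    ultimately have cl: "closedin T (fst ` W)" unfolding closed_map_def by blast
    have "N = topspace T - fst ` W"
    proof (intro equalityI subsetI)
      fix g assume g: "g \<in> N"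
      have "g \<notin> fst ` W"
      proof
        assume "g \<in> fst ` W"
        then obtain u v where "(g, u, v) \<in> W" by auto
        then have "u \<in> carrier G" "v \<in> carrier G" "\<not> (u \<otimes> g \<otimes> v \<in> U \<longleftrightarrow> u \<otimes> v \<in> U)"
          by (auto simp: W_def Z_def f_def h_def)
        then show False using N_D[OF g] by blast
      qed
      then show "g \<in> topspace T - fst ` W" using NG[OF g] by simp
    next
      fix g assume g: "g \<in> topspace T - fst ` W"
      have "u \<otimes> g \<otimes> v \<in> U \<longleftrightarrow> u \<otimes> v \<in> U" if uv: "u \<in> carrier G" "v \<in> carrier G" for u v
      proof (rule ccontr)
        assume "\<not> ?thesis"
        then have "(g, u, v) \<in> W" using uv g by (auto simp: W_def Z_def f_def h_def)
        then have "g \<in> fst ` W" by (rule image_eqI[rotated]) simp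
        then show False using g by blast
      qed
      then show "g \<in> N" unfolding N_def using g by simp
    qed
    then show ?thesis using cl by (simp add: closedin_def)
  qed
  moreover have "x \<notin> N" using N_D[of x \<one> \<one>] U x by auto
  ultimately show ?thesis using that by blast
qed

section \<open>Open subgroups\<close>

lemma openin_r_coset:
  assumes "openin T N" "g \<in> carrier G"
  shows "openin T (N #> g)"
proof -
  have "continuous_map T T (\<lambda>x. x \<otimes> inv g)"
    using assms(2) by (intro continuous_map_translation) simp
  then have "openin T {x \<in> topspace T. x \<otimes> inv g \<in> N}"
    using assms(1) by (rule openin_continuous_map_preimage)
  moreover have "N #> g = {x \<in> topspace T. x \<otimes> inv g \<in> N}"
  proof (intro equalityI subsetI)
    fix x assume "x \<in> N #> g"
    then obtain n where n: "n \<in> N" "x = n \<otimes> g" unfolding r_coset_def by blast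
    have "n \<in> carrier G" using n openin_subset[OF assms(1)] by auto
    then show "x \<in> {x \<in> topspace T. x \<otimes> inv g \<in> N}" using n assms(2) by (simp add: m_assoc)
  next
    fix x assume x: "x \<in> {x \<in> topspace T. x \<otimes> inv g \<in> N}"
    then have "x = (x \<otimes> inv g) \<otimes> g" using assms(2) by (simp add: m_assoc)
    then show "x \<in> N #> g" using x unfolding r_coset_def by blast
  qed
  ultimately show ?thesis by simp
qed

lemma rcosets_eq_of_mem:
  assumes "subgroup N G" "R \<in> rcosets N" "S \<in> rcosets N" "x \<in> R" "x \<in> S"
  shows "R = S"
  using rcos_disjoint[OF assms(1)] assms(2-) unfolding pairwise_def disjnt_def by blast

text \<open>The cosets are an open partition of a compact space, so a finite subcover already
  contains all of them.\<close>

lemma open_subgroup_finite_index: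
  assumes N: "subgroup N G" "openin T N"
  shows "finite (rcosets N)"
proof -
  have "openin T R" if "R \<in> rcosets N" for R
    using that openin_r_coset[OF N(2)] unfolding RCOSETS_def by blast
  then obtain \<F> where \<F>: "finite \<F>" "\<F> \<subseteq> rcosets N" "\<Union>\<F> = carrier G"
    using compact_T rcosets_part_G[OF N(1)] unfolding compact_space by (metis topspace_T)
  have "rcosets N \<subseteq> \<F>"
  proof
    fix R assume R: "R \<in> rcosets N"
    then obtain x where x: "x \<in> R" using subgroup.rcosets_non_empty[OF N(1)] by blast
    then have "x \<in> \<Union>\<F>" using \<F>(3) rcosets_part_G[OF N(1)] R by blast
    then obtain S where S: "S \<in> \<F>" "x \<in> S" by blast
    then have "R = S" using rcosets_eq_of_mem[OF N(1) R _ x] \<F>(2) by blast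
    then show "R \<in> \<F>" using S by simp
  qed
  then show ?thesis using \<F>(1) finite_subset by blast
qed

lemma open_subgroup_closed:
  assumes N: "subgroup N G" "openin T N"
  shows "closedin T N"
proof -
  have NR: "N \<in> rcosets N" by (rule subgroup.subgroup_in_rcosets[OF N(1) is_group])
  have "carrier G - N = \<Union>(rcosets N - {N})"
    using rcosets_part_G[OF N(1)] rcosets_eq_of_mem[OF N(1) NR] NR by blast
  moreover have "openin T (\<Union>(rcosets N - {N}))"
    using openin_r_coset[OF N(2)] unfolding RCOSETS_def by blast
  ultimately show ?thesis
    unfolding closedin_def using subgroup.subset[OF N(1)] by simp
qed

section \<open>Closures of subgroups\<close>

lemma closure_subgroup:
  assumes H: "subgroup H G"
  shows "subgroup (T closure_of H) G"
proof (rule subgroupI)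
  interpret H: subgroup H G by (rule H)
  have sub: "H \<subseteq> T closure_of H" by (rule closure_of_subset) (simp add: H.subset)
  show clG: "T closure_of H \<subseteq> carrier G" using closure_of_subset_topspace[of T H] by simp
  show "T closure_of H \<noteq> {}" using sub H.one_closed by blast
  show "inv a \<in> T closure_of H" if a: "a \<in> T closure_of H" for a
  proof (rule forall_in_closure_of[OF a])
    show "inv x \<in> T closure_of H" if "x \<in> H" for x using sub that by blast
    show "closedin T {x \<in> topspace T. inv x \<in> T closure_of H}"
      by (rule closedin_continuous_map_preimage[OF continuous_map_inv closedin_closure_of])
  qed
  \<comment> \<open>Continuity is used in one variable at a time: first the left factor is kept in
    \<open>H\<close>, then it ranges over the closure.\<close>
  have 1: "a \<otimes> b \<in> T closure_of H" if a: "a \<in> H" and b: "b \<in> T closure_of H" for a b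
  proof (rule forall_in_closure_of[OF b])
    show "a \<otimes> x \<in> T closure_of H" if "x \<in> H" for x using sub that a by blast
    show "closedin T {x \<in> topspace T. a \<otimes> x \<in> T closure_of H}"
      by (rule closedin_continuous_map_preimage[OF continuous_map_translation(1)[OF H.mem_carrier[OF a]]
            closedin_closure_of])
  qed
  show "a \<otimes> b \<in> T closure_of H" if a: "a \<in> T closure_of H" and b: "b \<in> T closure_of H" for a b
  proof (rule forall_in_closure_of[OF a])
    show "x \<otimes> b \<in> T closure_of H" if "x \<in> H" for x using 1 that b by blast
    show "closedin T {x \<in> topspace T. x \<otimes> b \<in> T closure_of H}"
      by (rule closedin_continuous_map_preimage[OF continuous_map_translation(2)[OF set_mp[OF clG b]]
            closedin_closure_of])
  qed
qed

lemma closure_normal: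
  assumes H: "H \<lhd> G"
  shows "T closure_of H \<lhd> G"
  unfolding normal_inv_iff
proof (intro conjI ballI)
  show "subgroup (T closure_of H) G" by (rule closure_subgroup[OF normal_imp_subgroup[OF H]])
  have sub: "H \<subseteq> T closure_of H"
    by (rule closure_of_subset) (simp add: subgroup.subset[OF normal_imp_subgroup[OF H]])
  fix g x assume g: "g \<in> carrier G" and x: "x \<in> T closure_of H"
  show "g \<otimes> x \<otimes> inv g \<in> T closure_of H"
  proof (rule forall_in_closure_of[OF x])
    show "g \<otimes> y \<otimes> inv g \<in> T closure_of H" if "y \<in> H" for y
      using normal.inv_op_closed2[OF H g that] sub by blast
    show "closedin T {x \<in> topspace T. g \<otimes> x \<otimes> inv g \<in> T closure_of H}"
      by (rule closedin_continuous_map_preimage[OF continuous_map_conj[OF g] closedin_closure_of])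
  qed
qed

text \<open>Equality of two continuous maps into a Hausdorff space is a closed condition; it is
  extended to the closure in one variable after the other.\<close>

lemma closure_commute:
  assumes H: "H \<subseteq> carrier G" and comm: "\<And>x y. \<lbrakk>x \<in> H; y \<in> H\<rbrakk> \<Longrightarrow> x \<otimes> y = y \<otimes> x"
    and x: "x \<in> T closure_of H" and y: "y \<in> T closure_of H"
  shows "x \<otimes> y = y \<otimes> x"
proof -
  note mult = continuous_map_translation
  have 1: "h \<otimes> z = z \<otimes> h" if h: "h \<in> H" and z: "z \<in> T closure_of H" for h z
    by (rule forall_in_closure_of_eq[OF z Hausdorff_T, of "\<lambda>z. h \<otimes> z" "\<lambda>z. z \<otimes> h"])
      (use h H mult[of h] comm in auto)
  have "y \<in> carrier G" using y closure_of_subset_topspace[of T H] by auto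
  then show ?thesis
    using forall_in_closure_of_eq[OF x Hausdorff_T, of "\<lambda>x. x \<otimes> y" "\<lambda>x. y \<otimes> x"] mult[of y] 1[OF _ y]
    by blast
qed

section \<open>Uniform bounds on class sizes\<close>

text \<open>Having at least \<open>n\<close> conjugates is an open condition. If it were dense for
  every \<open>n\<close>, Baire's theorem would give an element with infinitely many conjugates. So
  class sizes are bounded on some non-empty open set; finitely many translates of it cover
  \<open>A\<close>, and class sizes are submultiplicative.\<close>

lemma conj_class_bounded:
  assumes A: "subgroup A G" "closedin T A" and fin: "\<And>a. a \<in> A \<Longrightarrow> finite (conj_class a)"
  obtains n where "\<And>a. a \<in> A \<Longrightarrow> card (conj_class a) \<le> n"
proof -
  interpret A: subgroup A G by (rule A(1))
  define S where "S = subtopology T A"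
  have topS: "topspace S = A" unfolding S_def using A.subset by auto
  have compS: "compact_space S" unfolding S_def
    by (rule compact_space_subtopology[OF closedin_compact_space[OF compact_T A(2)]])
  have HS: "Hausdorff_space S" unfolding S_def by (rule Hausdorff_space_subtopology[OF Hausdorff_T])
  have contS: "continuous_map S T (\<lambda>x. g \<otimes> x \<otimes> inv g)" if "g \<in> carrier G" for g
    unfolding S_def by (rule continuous_map_from_subtopology[OF continuous_map_conj[OF that]])
  \<comment> \<open>Distinctness of the conjugates under finitely many elements is open, since each
    coincidence is a closed condition.\<close>
  define I where "I F = {y \<in> A. inj_on (\<lambda>g. g \<otimes> y \<otimes> inv g) F}" for F
  have openI: "openin S (I F)" if F: "finite F" "F \<subseteq> carrier G" for F
  proof -
    define P where "P = {(g, h). g \<in> F \<and> h \<in> F \<and> g \<noteq> h}"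
    have "finite P" by (rule finite_subset[of _ "F \<times> F"]) (use F in \<open>auto simp: P_def\<close>)
    moreover have "closedin S {y \<in> topspace S. g \<otimes> y \<otimes> inv g = h \<otimes> y \<otimes> inv h}" if "(g, h) \<in> P" for g h
      using that F(2) by (intro closedin_continuous_maps_eq[OF Hausdorff_T] contS) (auto simp: P_def)
    ultimately have "closedin S (\<Union>p\<in>P. {y \<in> topspace S. fst p \<otimes> y \<otimes> inv fst p = snd p \<otimes> y \<otimes> inv snd p})"
      by (intro closedin_Union) auto
    moreover have "I F = topspace S - (\<Union>p\<in>P. {y \<in> topspace S. fst p \<otimes> y \<otimes> inv fst p = snd p \<otimes> y \<otimes> inv snd p})"
      unfolding I_def topS P_def inj_on_def by auto
    ultimately show ?thesis by (simp add: closedin_def)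
  qed
  define D where "D n = (\<Union>F\<in>{F. finite F \<and> F \<subseteq> carrier G \<and> card F = n}. I F)" for n :: nat
  have openD: "openin S (D n)" for n unfolding D_def using openI by blast
  have D_iff: "y \<in> D n \<longleftrightarrow> n \<le> card (conj_class y)" if y: "y \<in> A" for y n
  proof
    assume "y \<in> D n"
    then obtain F where F: "finite F" "F \<subseteq> carrier G" "card F = n" "inj_on (\<lambda>g. g \<otimes> y \<otimes> inv g) F"
      unfolding D_def I_def by blast
    have "n = card ((\<lambda>g. g \<otimes> y \<otimes> inv g) ` F)" using card_image[OF F(4)] F(3) by simp
    also have "\<dots> \<le> card (conj_class y)"
      by (rule card_mono[OF fin[OF y]]) (use F(2) in \<open>auto simp: conj_class_def\<close>)
    finally show "n \<le> card (conj_class y)" .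
  next
    assume "n \<le> card (conj_class y)"
    then obtain C where C: "C \<subseteq> conj_class y" "card C = n" "finite C"
      by (rule obtain_subset_with_card_n)
    then obtain F where F: "F \<subseteq> carrier G" "inj_on (\<lambda>g. g \<otimes> y \<otimes> inv g) F" "C = (\<lambda>g. g \<otimes> y \<otimes> inv g) ` F"
      unfolding conj_class_def subset_image_inj by blast
    have "card F = n" using card_image[OF F(2)] F(3) C(2) by simp
    moreover have "finite F" using finite_imageD[OF _ F(2)] F(3) C(3) by simp
    ultimately show "y \<in> D n" unfolding D_def I_def using F y by blast
  qed
  have "\<exists>n. S closure_of (D n) \<noteq> topspace S"
  proof (rule ccontr)
    assume "\<not> ?thesis"
    then have dense: "S closure_of (D n) = topspace S" for n by blast
    have "S closure_of \<Inter>(range D) = topspace S"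
    proof (rule Baire_category)
      show "completely_metrizable_space S \<or> locally_compact_space S \<and> regular_space S"
        using compS HS compact_imp_locally_compact_space compact_Hausdorff_imp_regular_space by blast
    qed (use openD dense in auto)
    then have "S closure_of \<Inter>(range D) \<noteq> {}" using topS A.one_closed by blast
    then have "\<Inter>(range D) \<noteq> {}" using closure_of_empty[of S] by metis
    then obtain y where y: "y \<in> D n" for n by blast
    have "y \<in> A" using openin_subset[OF openD] y topS by blast
    then show False using D_iff[of y "Suc (card (conj_class y))"] y by simp
  qed
  then obtain n v where v: "v \<in> A" "v \<notin> S closure_of (D n)"
    using closure_of_subset_topspace topS by (metis subsetI subset_antisym)
  then obtain V where V: "openin S V" "v \<in> V" "V \<inter> D n = {}"
    unfolding in_closure_of topS by blast
  have VA: "V \<subseteq> A" using openin_subset[OF V(1)] topS by simp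
  have Vn: "card (conj_class y) \<le> n" if "y \<in> V" for y
    using D_iff[of y n] V(3) VA that by force
  \<comment> \<open>The translate of \<open>V\<close> by \<open>a \<otimes> inv v\<close>, which
    moves \<open>v\<close> to \<open>a\<close>.\<close>
  define P where "P a = {x \<in> topspace S. v \<otimes> inv a \<otimes> x \<in> V}" for a
  have "openin S (P a)" if a: "a \<in> A" for a
  proof -
    have "continuous_map S T (\<lambda>x. v \<otimes> inv a \<otimes> x)" unfolding S_def
      using a v(1) by (intro continuous_map_from_subtopology continuous_map_translation) simp
    moreover have "(\<lambda>x. v \<otimes> inv a \<otimes> x) \<in> topspace S \<rightarrow> A" using a v(1) topS by auto
    ultimately have "continuous_map S S (\<lambda>x. v \<otimes> inv a \<otimes> x)"
      unfolding S_def[symmetric] by (subst (2) S_def) (simp add: continuous_map_in_subtopology image_subset_iff_funcset)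
    then show ?thesis unfolding P_def using V(1) by (rule openin_continuous_map_preimage)
  qed
  moreover have "a \<in> P a" if "a \<in> A" for a
    unfolding P_def topS using that v(1) V(2) by (simp add: m_assoc)
  ultimately obtain \<F> where \<F>: "finite \<F>" "\<F> \<subseteq> P ` A" "topspace S \<subseteq> \<Union>\<F>"
    using compS[unfolded compact_space_alt, rule_format, of "P ` A"] topS by blast
  then obtain F where F: "F \<subseteq> A" "finite F" "\<F> = P ` F" by (meson finite_subset_image)
  define m where "m = (\<Sum>a\<in>F. card (conj_class (a \<otimes> inv v)))"
  show ?thesis
  proof (rule that[of "m * n"])
    fix x assume x: "x \<in> A"
    then obtain a where a: "a \<in> F" "x \<in> P a" using \<F>(3) F(3) topS by blast
    have aA: "a \<in> A" using a(1) F(1) by blast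
    define y where "y = v \<otimes> inv a \<otimes> x"
    have y: "y \<in> V" using a(2) unfolding P_def y_def by blast
    have yA: "y \<in> A" using y VA by blast
    have avA: "a \<otimes> inv v \<in> A" using aA v(1) by simp
    have "x = (a \<otimes> inv v) \<otimes> y" unfolding y_def using aA v(1) x by (simp add: group_normalize)
    then have "card (conj_class x) \<le> card (conj_class (a \<otimes> inv v)) * card (conj_class y)"
      using finite_conj_class_mult(2)[OF _ _ fin[OF avA] fin[OF yA]] avA yA by simp
    also have "\<dots> \<le> m * n"
    proof (rule mult_le_mono)
      show "card (conj_class (a \<otimes> inv v)) \<le> m" unfolding m_def
        using F(2) a(1) by (intro member_le_sum) auto
    qed (rule Vn[OF y])
    finally show "card (conj_class x) \<le> m * n" .
  qed
qed

end

subsection \<open>Profinite C-groups\<close>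

locale profinite_C = profinite +
  assumes profinite_C: "profinite_C_group G T"
begin

lemma ex_closed_complement:
  assumes "subgroup H G" "closedin T H"
  obtains K where "closedin T K" "perm_complement G H K"
  using assms profinite_C unfolding profinite_C_group_def by blast

lemma ex_complement_finite:
  assumes "subgroup H G" "finite H"
  shows "\<exists>K. perm_complement G H K"
  using ex_closed_complement[OF assms(1)] closedin_Hausdorff_finite[OF Hausdorff_T _ assms(2)]
    subgroup.subset[OF assms(1)] by auto

text \<open>Distinct elements of \<open>L\<close> lie in distinct cosets of \<open>N\<close>, of
  which there are finitely many.\<close>

lemma finite_complement_of_open:
  assumes N: "subgroup N G" "openin T N" and L: "perm_complement G N L"
  shows "finite L"
proof -
  have LG: "subgroup L G" by (rule perm_complement_subgroup[OF L])
  interpret N: subgroup N G by (rule N(1))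
  interpret L: subgroup L G by (rule LG)
  have "inj_on (\<lambda>l. N #> l) L"
  proof (rule inj_onI)
    fix k l assume kl: "k \<in> L" "l \<in> L" "N #> k = N #> l"
    have "k \<in> N #> l" using rcos_self[OF L.mem_carrier[OF kl(1)] N(1)] kl(3) by simp
    then have "k \<otimes> inv l \<in> N" by (rule N.rcos_module_imp[OF is_group L.mem_carrier[OF kl(2)]])
    moreover have "k \<otimes> inv l \<in> L" using kl by simp
    ultimately have "k \<otimes> inv l = \<one>" by (rule perm_complement_Int[OF L])
    then show "k = l" using kl inv_equality[of "inv l" k] inv_comm[of k "inv l"]
      by (metis L.mem_carrier inv_closed inv_equality inv_inv)
  qed
  moreover have "(\<lambda>l. N #> l) ` L \<subseteq> rcosets N" using rcosetsI[OF N.subset] L.mem_carrier by blast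
  ultimately show ?thesis
    using open_subgroup_finite_index[OF N] inj_on_finite by blast
qed

text \<open>A non-trivial commutator \<open>z\<close> of \<open>x\<close> and \<open>y\<close> would
  survive in the quotient by some open normal \<open>N\<close>. A complement \<open>L\<close> of
  \<open>N\<close> is a finite C-group representing this quotient, so commutators commute modulo
  \<open>N\<close> and \<open>z\<close> lies in \<open>N\<close> after all.\<close>

lemma commutators_commute:
  assumes x: "x \<in> derived_set G (carrier G)" and y: "y \<in> derived_set G (carrier G)"
  shows "x \<otimes> y = y \<otimes> x"
proof (rule ccontr)
  assume ne: "x \<otimes> y \<noteq> y \<otimes> x"
  have xG: "x \<in> carrier G" and yG: "y \<in> carrier G"
    using x[THEN set_mp[OF derived_set_in_carrier[OF subset_refl]]]
      y[THEN set_mp[OF derived_set_in_carrier[OF subset_refl]]] .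
  define z where "z = x \<otimes> y \<otimes> inv x \<otimes> inv y"
  have zG: "z \<in> carrier G" unfolding z_def using xG yG by simp
  have "z \<noteq> \<one>" unfolding z_def using commutator_eq_one_imp_commute[OF xG yG] ne by blast
  then obtain N where N: "N \<lhd> G" "openin T N" "z \<notin> N"
    using ex_open_normal_subgroup_separating[OF zG] by blast
  interpret N: normal N G by (rule N(1))
  obtain L where L: "perm_complement G N L"
    using ex_closed_complement[OF N.subgroup_axioms open_subgroup_closed[OF N.subgroup_axioms N(2)]]
    by blast
  have LG: "subgroup L G" by (rule perm_complement_subgroup[OF L])
  have finL: "finite L" by (rule finite_complement_of_open[OF N.subgroup_axioms N(2) L])
  \<comment> \<open>Subgroups of the finite group \<open>L\<close> are closed in \<open>G\<close>,
    hence complemented in \<open>G\<close>.\<close>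
  have "C_group (G\<lparr>carrier := L\<rparr>)"
    by (rule C_group_subgroup[OF LG]) (use ex_complement_finite finL finite_subset in blast)
  note LC = finite_C_group_commutators_commute[OF subgroup_imp_group[OF LG] _ this]
  have commL: "u \<otimes> v = v \<otimes> u" if "u \<in> derived_set G L" "v \<in> derived_set G L" for u v
  proof -
    have "derived_set (G\<lparr>carrier := L\<rparr>) (carrier (G\<lparr>carrier := L\<rparr>)) = derived_set G L"
      using derived_set_consistent[OF subset_refl LG] by simp
    from LC[unfolded this, of u v] show ?thesis using finL that by simp
  qed
  interpret Q: group "G Mod N" by (rule N.factorgroup_is_group)
  interpret \<pi>: group_hom G "G Mod N" "\<lambda>g. N #> g"
    by (unfold_locales) (rule N.r_coset_hom_Mod)
  have red: "\<exists>l\<in>L. N #> l = N #> g" if g: "g \<in> carrier G" for g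
  proof -
    obtain n l where nl: "n \<in> N" "l \<in> L" "g = n \<otimes> l"
      using perm_complement_decomp[OF L N.subgroup_axioms subgroup_self N.subset g] .
    have "g \<in> N #> l" unfolding r_coset_def using nl by blast
    then have "N #> l = N #> g"
      by (rule repr_independence[OF _ subgroup.mem_carrier[OF LG nl(2)] N.subgroup_axioms])
    then show ?thesis using nl(2) by blast
  qed
  have red_comm: "\<exists>c\<in>derived_set G L. N #> c = N #> w" if w: "w \<in> derived_set G (carrier G)" for w
  proof -
    obtain a b where ab: "a \<in> carrier G" "b \<in> carrier G" "w = a \<otimes> b \<otimes> inv a \<otimes> inv b" using w by blast
    obtain k where k: "k \<in> L" "N #> k = N #> a" using red[OF ab(1)] by blast
    obtain l where l: "l \<in> L" "N #> l = N #> b" using red[OF ab(2)] by blast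
    have kl: "k \<in> carrier G" "l \<in> carrier G" using k l subgroup.mem_carrier[OF LG] by blast+
    have "N #> (k \<otimes> l \<otimes> inv k \<otimes> inv l) = N #> w" unfolding ab(3) using ab(1,2) kl k(2) l(2) by simp
    then show ?thesis using k(1) l(1) by blast
  qed
  obtain x' where x': "x' \<in> derived_set G L" "N #> x' = N #> x" using red_comm[OF x] by (rule bexE)
  obtain y' where y': "y' \<in> derived_set G L" "N #> y' = N #> y" using red_comm[OF y] by (rule bexE)
  have x'G: "x' \<in> carrier G" and y'G: "y' \<in> carrier G"
    using x'(1)[THEN set_mp[OF derived_set_in_carrier[OF subgroup.subset[OF LG]]]]
      y'(1)[THEN set_mp[OF derived_set_in_carrier[OF subgroup.subset[OF LG]]]] .
  have "N #> z = N #> (x' \<otimes> y' \<otimes> inv x' \<otimes> inv y')"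
    unfolding z_def using xG yG x'G y'G x'(2) y'(2) by simp
  also have "x' \<otimes> y' \<otimes> inv x' \<otimes> inv y' = \<one>"
    unfolding commL[OF x'(1) y'(1)] using x'G y'G by (simp add: group_normalize)
  finally have "N #> z = N" using N.subset by simp
  then have "z \<in> N" by (rule coset_join1[OF _ zG N.subgroup_axioms])
  then show False using N(3) by simp
qed

section \<open>The closure of the derived subgroup and its complements\<close>

definition derived_closure :: "'a set" where
  "derived_closure = T closure_of (derived G (carrier G))"

lemma derived_closure_normal: "derived_closure \<lhd> G"
  unfolding derived_closure_def by (rule closure_normal[OF derived_self_is_normal])

lemma derived_closure_closed: "closedin T derived_closure"
  unfolding derived_closure_def by simp

text \<open>Commutation passes from the commutators to the subgroup they generate and from there to
  its closure.\<close>

lemma derived_closure_commute: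
  assumes "x \<in> derived_closure" "y \<in> derived_closure"
  shows "x \<otimes> y = y \<otimes> x"
proof (rule closure_commute[OF _ _ assms[unfolded derived_closure_def]])
  note ds = derived_set_in_carrier[OF subset_refl]
  show "u \<otimes> v = v \<otimes> u" if "u \<in> derived G (carrier G)" "v \<in> derived G (carrier G)" for u v
    by (rule generate_centralizes[OF ds ds commutators_commute that[unfolded derived_def]])
qed (rule derived_in_carrier[OF subset_refl])

text \<open>Commutators of elements of \<open>B\<close> lie in the derived subgroup and in
  \<open>B\<close>, so they are trivial.\<close>

lemma ex_derived_closure_complement:
  obtains B where "perm_complement G derived_closure B"
    "\<And>x y. \<lbrakk>x \<in> B; y \<in> B\<rbrakk> \<Longrightarrow> x \<otimes> y = y \<otimes> x"
proof -
  interpret A: normal derived_closure G by (rule derived_closure_normal)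
  obtain B where B: "perm_complement G derived_closure B"
    using ex_closed_complement[OF A.subgroup_axioms derived_closure_closed] .
  interpret B: subgroup B G by (rule perm_complement_subgroup[OF B])
  have "x \<otimes> y = y \<otimes> x" if xy: "x \<in> B" "y \<in> B" for x y
  proof (rule commutator_eq_one_imp_commute)
    have "x \<otimes> y \<otimes> inv x \<otimes> inv y \<in> derived_set G (carrier G)"
      using B.mem_carrier[OF xy(1)] B.mem_carrier[OF xy(2)] by blast
    then have "x \<otimes> y \<otimes> inv x \<otimes> inv y \<in> derived G (carrier G)" unfolding derived_def by (rule generate.incl)
    then have "x \<otimes> y \<otimes> inv x \<otimes> inv y \<in> derived_closure" unfolding derived_closure_def
      by (rule set_mp[OF closure_of_subset, rotated]) (simp add: derived_in_carrier)
    moreover have "x \<otimes> y \<otimes> inv x \<otimes> inv y \<in> B" using xy by simp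
    ultimately show "x \<otimes> y \<otimes> inv x \<otimes> inv y = \<one>" by (rule perm_complement_Int[OF B])
  qed (use xy in simp_all)
  then show ?thesis using that B by blast
qed

text \<open>The criterion by eigenelements is applied inside \<open>B\<close>, which is both the
  normal subgroup and the whole group, with the trivial complement. Conjugacy classes in
  \<open>B\<close> are singletons, and complements of its finite subgroups come from
  \<open>G\<close>.\<close>

lemma C_group_of_abelian_subgroup:
  assumes tors: "torsion_group G" and BG: "subgroup B G"
    and comm: "\<And>x y. \<lbrakk>x \<in> B; y \<in> B\<rbrakk> \<Longrightarrow> x \<otimes> y = y \<otimes> x"
  shows "C_group (G\<lparr>carrier := B\<rparr>)"
proof -
  define B' where "B' = G\<lparr>carrier := B\<rparr>"
  interpret B: group B' unfolding B'_def by (rule subgroup_imp_group[OF BG])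
  have [simp]: "carrier B' = B" "mult B' = mult G" "one B' = one G" by (simp_all add: B'_def)
  have BN: "B \<lhd> B'" using B.normal_self by simp
  have "B \<subseteq> generate B' (B \<inter> B.eigenelements)"
  proof (rule B.generated_by_eigenelements_if_finite_conj_class[OF BN])
    show "x \<otimes>\<^bsub>B'\<^esub> y = y \<otimes>\<^bsub>B'\<^esub> x" if "x \<in> B" "y \<in> B" for x y using comm[OF that] by simp
    show "B.ord x \<noteq> 0" if x: "x \<in> B" for x
    proof -
      obtain n :: nat where n: "n > 0" "x [^] n = \<one>"
        using tors subgroup.mem_carrier[OF BG x] unfolding torsion_group_def by blast
      have "x [^]\<^bsub>B'\<^esub> n = \<one>\<^bsub>B'\<^esub>" using n(2) nat_pow_consistent[of x n B] by (simp add: B'_def)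
      then show ?thesis using B.ord_eq_0[of x] x n(1) by auto
    qed
    show "finite (B.conj_class x)" if x: "x \<in> B" for x
    proof -
      have "g \<otimes>\<^bsub>B'\<^esub> x \<otimes>\<^bsub>B'\<^esub> inv\<^bsub>B'\<^esub> g = x" if g: "g \<in> B" for g
        using B.conj_fixed_iff_commute[of g x] comm[OF g x] g x by simp
      then have "B.conj_class x \<subseteq> {x}" unfolding B.conj_class_def by auto
      then show ?thesis by (rule finite_subset) simp
    qed
    show "\<exists>K. perm_complement B' H K" if H: "subgroup H B'" "finite H" for H
    proof -
      have HG: "subgroup H G" using incl_subgroup[OF BG] H(1) unfolding B'_def .
      have HB: "H \<subseteq> B" using subgroup.subset[OF H(1)] by simp
      obtain K where "perm_complement G H K" using ex_complement_finite[OF HG H(2)] by blast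
      then show ?thesis using perm_complement_Int_subgroup[OF BG HG HB] unfolding B'_def by blast
    qed
  qed
  moreover have "perm_complement B' B {\<one>\<^bsub>B'\<^esub>}"
  proof (rule B.perm_complementI)
    show "subgroup B B'" using B.subgroup_self by simp
    show "\<exists>h\<in>B. \<exists>k\<in>{\<one>\<^bsub>B'\<^esub>}. g = h \<otimes>\<^bsub>B'\<^esub> k" if "g \<in> carrier B'" for g
      by (rule bexI[of _ g]) (use that B.r_one[OF that] in simp_all)
  qed (use B.triv_subgroup in auto)
  moreover have "C_group (B'\<lparr>carrier := {\<one>\<^bsub>B'\<^esub>}\<rparr>)"
  proof (rule B.C_group_subgroup[OF B.triv_subgroup])
    fix H assume H: "subgroup H B'" "H \<subseteq> {\<one>\<^bsub>B'\<^esub>}"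
    have "perm_complement B' H (carrier B')"
    proof (rule B.perm_complementI[OF H(1) B.subgroup_self])
      show "\<exists>h\<in>H. \<exists>k\<in>carrier B'. g = h \<otimes>\<^bsub>B'\<^esub> k" if "g \<in> carrier B'" for g
        using subgroup.one_closed[OF H(1)] B.l_one[OF that] that by (metis)
    qed (use H(2) in auto)
    then show "\<exists>K. perm_complement B' H K" by blast
  qed
  ultimately have "C_group B'" by (rule B.C_group_if_generated_by_eigenelements[OF BN])
  then show ?thesis unfolding B'_def .
qed

section \<open>The two implications\<close>

text \<open>The product of the center and the abelian \<open>derived_closure\<close> centralizes
  \<open>derived_closure\<close>. Finite index thus makes the classes there finite, and torsion then
  gives generation by eigenelements.\<close>

lemma C_group_if_torsion_finite_index:
  assumes tors: "torsion_group G"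
    and fin: "finite (rcosets (group_center G <#> derived_closure))"
  shows "C_group G"
proof -
  interpret A: normal derived_closure G by (rule derived_closure_normal)
  interpret Z: normal "group_center G" G by (rule group_center_normal)
  obtain B where B: "perm_complement G derived_closure B"
    and comm: "\<And>x y. \<lbrakk>x \<in> B; y \<in> B\<rbrakk> \<Longrightarrow> x \<otimes> y = y \<otimes> x"
    using ex_derived_closure_complement by blast
  have MG: "subgroup (group_center G <#> derived_closure) G"
    by (rule mult_norm_subgroup[OF group_center_normal A.subgroup_axioms])
  have "derived_closure \<subseteq> generate G (derived_closure \<inter> eigenelements)"
  proof (rule generated_by_eigenelements_if_finite_conj_class[OF derived_closure_normal derived_closure_commute])
    show "ord x \<noteq> 0" if "x \<in> derived_closure" for x
      using tors that unfolding torsion_group_iff by simp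
    show "finite (conj_class x)" if x: "x \<in> derived_closure" for x
    proof (rule finite_conj_class_if_finite_index[OF subgroup.subset[OF MG] fin _ subgroup.one_closed[OF MG]])
      fix m assume "m \<in> group_center G <#> derived_closure"
      then obtain z a where za: "z \<in> group_center G" "a \<in> derived_closure" "m = z \<otimes> a"
        unfolding set_mult_def by blast
      have c: "z \<in> carrier G" "a \<in> carrier G" "x \<in> carrier G" using za x by simp_all
      have zx: "z \<otimes> x = x \<otimes> z" using za(1) c(3) unfolding group_center_def by blast
      have "m \<otimes> x = z \<otimes> (a \<otimes> x)" unfolding za(3) using c by (simp add: m_assoc)
      also have "\<dots> = (z \<otimes> x) \<otimes> a" unfolding derived_closure_commute[OF za(2) x] using c by (simp add: m_assoc)
      also have "\<dots> = x \<otimes> m" unfolding zx za(3) using c by (simp add: m_assoc)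
      finally show "m \<otimes> x = x \<otimes> m" .
    qed (use x in simp)
    show "\<exists>K. perm_complement G H K" if "subgroup H G" "finite H" for H
      using ex_complement_finite[OF that] .
  qed
  moreover have "C_group (G\<lparr>carrier := B\<rparr>)"
    by (rule C_group_of_abelian_subgroup[OF tors perm_complement_subgroup[OF B] comm])
  ultimately show ?thesis
    using C_group_if_generated_by_eigenelements[OF derived_closure_normal _ B] by blast
qed

text \<open>The centralizer of a suitable \<open>x\<close> centralizes all of
  \<open>derived_closure\<close>. For \<open>g = a \<otimes> b\<close> in it, the factor
  \<open>b\<close> then centralizes \<open>derived_closure\<close> and also the abelian
  \<open>B\<close>, so it is central. The index is finite because the class of \<open>x\<close>
  is.\<close>

lemma C_group_imp_finite_index:
  assumes C: "C_group G"
  shows "finite (rcosets (group_center G <#> derived_closure))"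
proof -
  interpret A: normal derived_closure G by (rule derived_closure_normal)
  obtain B where B: "perm_complement G derived_closure B"
    and comm: "\<And>x y. \<lbrakk>x \<in> B; y \<in> B\<rbrakk> \<Longrightarrow> x \<otimes> y = y \<otimes> x"
    using ex_derived_closure_complement by blast
  have BG: "subgroup B G" by (rule perm_complement_subgroup[OF B])
  have Agen: "derived_closure \<subseteq> generate G (derived_closure \<inter> eigenelements)"
  proof (rule abelian_normal_generated_by_eigenelements[OF derived_closure_normal derived_closure_commute])
    show "ord x \<noteq> 0" if "x \<in> derived_closure" for x
      using C_group_imp_ord_neq_0[OF C A.mem_carrier[OF that]] .
    show "\<exists>K. perm_complement G H K" if "subgroup H G" for H
      using C that by (simp add: C_group_def)
  qed
  have fin: "finite (conj_class a)" if "a \<in> derived_closure" for a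
    using finite_conj_class_generated_by_eigenelements[OF set_mp[OF Agen that]] .
  obtain n where n: "\<And>a. a \<in> derived_closure \<Longrightarrow> card (conj_class a) \<le> n"
    using conj_class_bounded[OF A.subgroup_axioms derived_closure_closed fin] by blast
  obtain x where x: "x \<in> derived_closure"
    and cent: "\<And>u a. \<lbrakk>u \<in> carrier G; u \<otimes> x = x \<otimes> u; a \<in> derived_closure\<rbrakk> \<Longrightarrow> u \<otimes> a = a \<otimes> u"
    using centralizer_of_maximal_conj_class[OF derived_closure_normal derived_closure_commute Agen n] by blast
  show ?thesis
  proof (rule finite_index_if_finite_conj_class[OF _ fin[OF x] A.mem_carrier[OF x]])
    show "subgroup (group_center G <#> derived_closure) G"
      by (rule mult_norm_subgroup[OF group_center_normal A.subgroup_axioms])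
    fix g assume g: "g \<in> carrier G" "g \<otimes> x = x \<otimes> g"
    obtain a b where ab: "a \<in> derived_closure" "b \<in> B" "g = a \<otimes> b"
      using perm_complement_decomp[OF B A.subgroup_axioms subgroup_self A.subset g(1)] .
    have aG: "a \<in> carrier G" and bG: "b \<in> carrier G"
      using A.mem_carrier[OF ab(1)] subgroup.mem_carrier[OF BG ab(2)] .
    \<comment> \<open>Both \<open>g\<close> and \<open>a\<close> commute with \<open>c\<close>,
      hence so does \<open>b\<close>.\<close>
    have b_a: "b \<otimes> c = c \<otimes> b" if c: "c \<in> derived_closure" for c
    proof -
      have cG: "c \<in> carrier G" using c by simp
      have "a \<otimes> (b \<otimes> c) = g \<otimes> c" unfolding ab(3) using aG bG cG by (simp add: m_assoc)
      also have "\<dots> = c \<otimes> g" by (rule cent[OF g c])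
      also have "\<dots> = (c \<otimes> a) \<otimes> b" unfolding ab(3) using aG bG cG by (simp add: m_assoc)
      also have "\<dots> = a \<otimes> (c \<otimes> b)"
        unfolding derived_closure_commute[OF c ab(1)] using aG bG cG by (simp add: m_assoc)
      finally show ?thesis using aG bG cG by simp
    qed
    have "b \<otimes> h = h \<otimes> b" if h: "h \<in> carrier G" for h
    proof -
      obtain c d where cd: "c \<in> derived_closure" "d \<in> B" "h = c \<otimes> d"
        using perm_complement_decomp[OF B A.subgroup_axioms subgroup_self A.subset h] .
      have cG: "c \<in> carrier G" and dG: "d \<in> carrier G"
        using A.mem_carrier[OF cd(1)] subgroup.mem_carrier[OF BG cd(2)] .
      have "b \<otimes> h = (b \<otimes> c) \<otimes> d" unfolding cd(3) using bG cG dG by (simp add: m_assoc)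
      also have "\<dots> = c \<otimes> (b \<otimes> d)" unfolding b_a[OF cd(1)] using bG cG dG by (simp add: m_assoc)
      also have "\<dots> = h \<otimes> b" unfolding comm[OF ab(2) cd(2)] cd(3) using bG cG dG by (simp add: m_assoc)
      finally show ?thesis .
    qed
    then have "b \<in> group_center G" unfolding group_center_def using bG by blast
    moreover have "g = b \<otimes> a" unfolding ab(3) by (rule b_a[OF ab(1), symmetric])
    ultimately show "g \<in> group_center G <#> derived_closure" using ab(1) unfolding set_mult_def by blast
  qed
qed

end

theorem theoremC:
  assumes "profinite_C_group G T"
  shows "(C_group G \<longleftrightarrow>
            torsion_group G \<and>
            finite (rcosets\<^bsub>G\<^esub> (group_center G <#>\<^bsub>G\<^esub> (T closure_of derived G (carrier G)))))
       \<and> (comm_group G \<longrightarrow> (C_group G \<longleftrightarrow> torsion_group G))"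
proof -
  have "profinite_group G T" using assms by (simp add: profinite_C_group_def)
  moreover from this have "group G" by (simp add: profinite_group_def topological_group_def)
  ultimately interpret profinite_C G T
    using assms by (intro profinite_C.intro profinite.intro profinite_axioms.intro profinite_C_axioms.intro)
  let ?M = "group_center G <#>\<^bsub>G\<^esub> derived_closure"
  have iff: "C_group G \<longleftrightarrow> torsion_group G \<and> finite (rcosets\<^bsub>G\<^esub> ?M)"
    using C_group_if_torsion_finite_index C_group_imp_finite_index C_group_imp_ord_neq_0
      torsion_group_iff by blast
  \<comment> \<open>In the commutative case the center is everything, so there is a single
    coset.\<close>
  have "finite (rcosets\<^bsub>G\<^esub> ?M)" if "comm_group G"
  proof -
    interpret comm_group G by (rule that)
    interpret A: normal derived_closure G by (rule derived_closure_normal)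
    have "group_center G = carrier G" unfolding group_center_def using m_comm by blast
    then have "carrier G \<subseteq> ?M" using subset_set_mult_left[OF subset_refl A.one_closed] by simp
    moreover have "?M \<subseteq> carrier G"
      by (rule setmult_subset_G[OF _ A.subset]) (auto simp: group_center_def)
    ultimately have "?M = carrier G" by (rule equalityI[rotated])
    moreover have "rcosets\<^bsub>G\<^esub> (carrier G) \<subseteq> {carrier G}"
      unfolding RCOSETS_def using coset_join2[OF _ subgroup_self] by auto
    ultimately show ?thesis using finite_subset by auto
  qed
  with iff show ?thesis unfolding derived_closure_def by blast
qed

end
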